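(* Let $k$ be a fixed positive integer. Then the length $\operatorname{as}_{n,k}$ of the longest $k$-alternating subsequence of a uniformly random permutation in $S_n$ satisfies a central limit theorem: as $n\to\infty$, $$\frac{\operatorname{as}_{n,k}-\mathbb{E}[\operatorname{as}_{n,k}]}{\sqrt{\operatorname{Var}(\operatorname{as}_{n,k})}} \longrightarrow_{d} \mathcal{G},$$ where $\mathcal{G}$ is the standard normal distribution and $\longrightarrow_d$ denotes convergence in distribution.
   Context: $S_n$ is the symmetric group on $\{1,\dots,n\}$. For $\sigma\in S_n$ and an integer $k\ge 1$, a subsequence of indices $1\le i_1<i_2<\cdots<i_t\le n$ is $k$-alternating for $\sigma$ if $$\sigma(i_1)\ge\sigma(i_2)+k,\quad \sigma(i_2)+k\le\sigma(i_3),\quad \sigma(i_3)\ge\sigma(i_4)+k,\ \dots,$$ i.e. $\sigma(i_1)>\sigma(i_2)<\sigma(i_3)>\cdots$ (starting with a descent) and $|\sigma(i_j)-\sigma(i_{j+1})|\ge k$ for all $1\le j\le t-1$. Its length is $t$ (a single index is $k$-alternating of length $1$). $\operatorname{as}_{n,k}(\sigma)$ is the largest length of a $k$-alternating subsequence for $\sigma$; $\operatorname{as}_{n,k}$ is regarded as a random variable by taking $\sigma$ uniformly distributed on $S_n$. *)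

theory Defs
  imports "HOL-Probability.Probability"
begin

text \<open>An index sequence \<open>i\<^sub>1 < \<dots> < i\<^sub>t\<close> is the list \<open>is\<close> with \<open>i\<^sub>j = is ! (j - 1)\<close>. List positions
  start at 0, so the descents required at \<open>j = 1, 3, \<dots>\<close> are those at even list positions.
  The conditions are written additively because subtraction on \<^typ>\<open>nat\<close> truncates.\<close>

definition k_alternating :: "nat \<Rightarrow> nat \<Rightarrow> (nat \<Rightarrow> nat) \<Rightarrow> nat list \<Rightarrow> bool" where
  "k_alternating n k \<sigma> is \<longleftrightarrow>
     set is \<subseteq> {1..n} \<and> sorted_wrt (<) is \<and>
     (\<forall>j. Suc j < length is \<longrightarrow>
        (if even j then \<sigma> (is ! j) \<ge> \<sigma> (is ! Suc j) + k
         else \<sigma> (is ! j) + k \<le> \<sigma> (is ! Suc j)))"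

text \<open>The empty list counts as alternating, of length 0; this only matters for \<open>n = 0\<close>.\<close>

definition las :: "nat \<Rightarrow> nat \<Rightarrow> (nat \<Rightarrow> nat) \<Rightarrow> nat" where
  "las n k \<sigma> = Max {length is | is. k_alternating n k \<sigma> is}"

lemma finite_k_alternating_lengths: "finite {length is | is. k_alternating n k \<sigma> is}"
proof (rule finite_subset)
  show "{length is | is. k_alternating n k \<sigma> is} \<subseteq> {..n}"
  proof clarify
    fix xs assume "k_alternating n k \<sigma> xs"
    hence "set xs \<subseteq> {1..n}" "distinct xs"
      by (auto simp: k_alternating_def strict_sorted_iff)
    thus "length xs \<le> n"
      using card_mono[of "{1..n}" "set xs"] by (simp add: distinct_card)
  qed
qed simp

lemma k_alternating_lengths_nonempty: "{length is | is. k_alternating n k \<sigma> is} \<noteq> {}"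
proof -
  have "k_alternating n k \<sigma> []" by (simp add: k_alternating_def)
  thus ?thesis by blast
qed

definition uniform_perm :: "nat \<Rightarrow> (nat \<Rightarrow> nat) pmf" where
  "uniform_perm n = pmf_of_set {\<sigma>. \<sigma> permutes {1..n}}"

end

theory Submission
  imports Defs "HOL-Real_Asymp.Real_Asymp"
begin

text \<open>
  For fixed \<open>k\<close> the constraint that consecutive chosen values differ by at least \<open>k\<close> hardly matters:
  in a random permutation only a bounded number of pairs of neighbouring entries, on average, have
  values at distance less than \<open>k\<close>. The longest \<open>k\<close>-alternating subsequence is therefore about as long as the
  sequence of local extrema, that is, twice the number of peaks. The proof makes this precise and
  then proves a central limit theorem for the number of peaks.

  Comparison (\<open>las_near_peaks\<close>). Write \<open>\<sigma>\<close> as a word. A greedy scan that changes direction only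
  after a move of at least \<open>k\<close> produces a \<open>k\<close>-alternating subsequence, and it loses at most two turns
  for every pair of neighbours whose values are closer than \<open>k\<close>. Conversely, no alternating
  subsequence is much longer than the number of turns of the word. So the length differs from twice
  the number of peaks by at most \<open>2 + 2 * close_pairs\<close>.

  Insertion. A uniform permutation of size \<open>n + 1\<close> arises from one of size \<open>n\<close> by inserting the new
  largest letter into one of the \<open>n + 1\<close> gaps, uniformly at random. If words are thought to be
  preceded and followed by a letter below all others, the new letter is always a peak, and it
  destroys an old peak exactly if it is put next to one. Hence the number \<open>p\<close> of peaks is a Markov chain: it stays the
  same with probability \<open>2p/(n+1)\<close> and increases by one otherwise (\<open>average_peaks_Suc\<close>). In the same
  way an insertion destroys a close pair with probability proportional to their number and creates
  new ones with probability \<open>O(k/n)\<close>, so that their first two moments stay bounded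
  (\<open>average_close_pairs\<close>).

  Central limit theorem for peaks. The increments of the chain are affine in the current state, so
  the deviation from the mean \<open>(n+1)/3\<close> is, after multiplication by \<open>n(n-1)\<close>, a martingale. Its
  conditional variances are nearly deterministic, because the second moment of the deviation is
  only \<open>O(n)\<close>. The characteristic function of the deviation
  thus satisfies an approximate one-step recursion (\<open>peak_char_Suc\<close>), which is unrolled and
  converges to \<open>exp (-t\<^sup>2/2)\<close> (\<open>peak_char_tendsto\<close>).

  Transfer. The mean square difference of the two statistics is bounded while both variances grow
  linearly, so standardizing them leads to random variables whose \<open>L\<^sup>1\<close> distance tends to 0
  (\<open>standardized_near\<close>). Their characteristic functions have the same limit, and Levy's continuity
  theorem gives the result.
\<close>

section \<open>Zigzags, turns and peaks of a word\<close>

text \<open>A word is scanned from its first letter \<open>a\<close> onwards; the flag \<open>up\<close> says whether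
  the scan arrived at \<open>a\<close> by an ascent.\<close>
fun turns :: "nat \<Rightarrow> bool \<Rightarrow> nat list \<Rightarrow> nat" where
  "turns a up [] = 0"
| "turns a up (x # xs) = of_bool ((a < x) \<noteq> up) + turns x (a < x) xs"

text \<open>A peak is counted when the scan leaves it. An ascent that reaches the end of the word counts as well, as
  if the word were followed by a letter below all others.\<close>
fun peaks_from :: "nat \<Rightarrow> bool \<Rightarrow> nat list \<Rightarrow> nat" where
  "peaks_from a up [] = of_bool up"
| "peaks_from a up (x # xs) = of_bool (up \<and> \<not> a < x) + peaks_from x (a < x) xs"

text \<open>Starting with \<open>up = True\<close> amounts to a letter below all others in front of the word.\<close>
fun peaks :: "nat list \<Rightarrow> nat" where
  "peaks [] = 0"
| "peaks (x # xs) = peaks_from x True xs"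

fun close_pairs_from :: "nat \<Rightarrow> nat \<Rightarrow> nat list \<Rightarrow> nat" where
  "close_pairs_from k a [] = 0"
| "close_pairs_from k a (x # xs) = of_bool (x < a + k \<and> a < x + k) + close_pairs_from k x xs"

fun close_pairs :: "nat \<Rightarrow> nat list \<Rightarrow> nat" where
  "close_pairs k [] = 0"
| "close_pairs k (x # xs) = close_pairs_from k x xs"

text \<open>The value \<open>v\<close> is the most extreme one seen since the last counted turn (a maximum if
  \<open>up\<close>, a minimum otherwise). It is provisional: a turn is counted only when the word has moved back from
  it by at least \<open>k\<close>.\<close>
fun greedy :: "nat \<Rightarrow> nat \<Rightarrow> bool \<Rightarrow> nat list \<Rightarrow> nat" where
  "greedy k v up [] = 0"
| "greedy k v up (x # xs) =
    (if up then if x + k \<le> v then Suc (greedy k x False xs) else greedy k (max v x) True xs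
     else if v + k \<le> x then Suc (greedy k x True xs) else greedy k (min v x) False xs)"

fun zigzag :: "nat \<Rightarrow> bool \<Rightarrow> nat list \<Rightarrow> bool" where
  "zigzag k up (x # y # ys) \<longleftrightarrow> (if up then x + k \<le> y else y + k \<le> x) \<and> zigzag k (\<not> up) (y # ys)"
| "zigzag k up _ \<longleftrightarrow> True"

text \<open>Turns are alternately peaks and valleys, which leaves only boundary effects.\<close>
lemma peaks_turns:
  "turns a up xs + of_bool up \<le> 2 * peaks_from a up xs"
  "2 * peaks_from a up xs \<le> turns a up xs + 1 + of_bool up"
proof (induction xs arbitrary: a up)
  case (Cons x xs)
  { case 1 show ?case using Cons(1)[of x "a < x"] by (auto split: if_splits) }
  { case 2 show ?case using Cons(2)[of x "a < x"] by (auto split: if_splits) }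
qed auto

text \<open>The provisional extremes at the moments when turns are counted form a zigzag. The first element
  \<open>y\<close> may be taken at least as extreme as the starting value \<open>v\<close>; this is what allows the
  induction to prepend the previous extreme.\<close>
lemma greedy_zigzag:
  "\<exists>y ys. subseq (y # ys) (v # xs) \<and> zigzag k (\<not> up) (y # ys) \<and> length ys = greedy k v up xs
      \<and> (if up then v \<le> y else y \<le> v)"
proof (induction xs arbitrary: v up)
  case Nil
  show ?case by (rule exI[of _ v], rule exI[of _ "[]"]) auto
next
  case (Cons x xs)
  show ?case
  proof (cases "if up then x + k \<le> v else v + k \<le> x")
    case True
    obtain y ys where y: "subseq (y # ys) (x # xs)" "zigzag k up (y # ys)"
        "length ys = greedy k x (\<not> up) xs" "if \<not> up then x \<le> y else y \<le> x"
      using Cons[of x "\<not> up"] by (simp only: not_not) blast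
    have "subseq (v # y # ys) (v # x # xs)" using y(1) by simp
    moreover have "zigzag k (\<not> up) (v # y # ys)" using y True by (auto split: if_splits)
    ultimately show ?thesis using y(3) True
      by (intro exI[of _ v] exI[of _ "y # ys"]) (auto split: if_splits)
  next
    case False
    define w where "w = (if up then max v x else min v x)"
    obtain y ys where y: "subseq (y # ys) (w # xs)" "zigzag k (\<not> up) (y # ys)"
        "length ys = greedy k w up xs" "if up then w \<le> y else y \<le> w"
      using Cons[of w up] by blast
    have "w = v \<or> w = x" by (auto simp: w_def)
    hence "subseq (w # xs) (v # x # xs)" by (auto intro: list_emb.intros)
    hence "subseq (y # ys) (v # x # xs)" using y(1) subseq_order.order_trans by blast
    thus ?thesis using y(2-) False
      by (intro exI[of _ y] exI[of _ ys]) (auto simp: w_def split: if_splits)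
  qed
qed

text \<open>The hypothesis says that the current letter \<open>a\<close> lies within \<open>k\<close> of the greedy
  extreme \<open>v\<close>, which is always the case between two counted turns. A step of size at least
  \<open>k\<close> then brings the greedy scan and the plain scan to the same letter and direction. Only a close pair
  can make the two directions differ, and a pending difference costs at most one turn later on, whence the term
  \<open>of_bool (up \<noteq> up')\<close> and the factor 2.\<close>
lemma turns_le_greedy:
  assumes "if up then a \<le> v \<and> v < a + k else v \<le> a \<and> a < v + k"
  shows "turns a up' xs \<le> greedy k v up xs + 2 * close_pairs_from k a xs + of_bool (up \<noteq> up')"
  using assms
proof (induction xs arbitrary: a v up up')
  case (Cons x xs)
  define c where "c \<longleftrightarrow> (if up then x + k \<le> v else v + k \<le> x)"
  define w where "w = (if c then x else if up then max v x else min v x)"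
  define u where "u = (if c then \<not> up else up)"
  have g: "greedy k v up (x # xs) = of_bool c + greedy k w u xs"
    by (auto simp: c_def w_def u_def)
  \<comment> \<open>\<open>w\<close> and \<open>u\<close> are the extreme and the direction of the greedy scan after reading \<open>x\<close>.\<close>
  have "turns x (a < x) xs \<le> greedy k w u xs + 2 * close_pairs_from k x xs + of_bool (u \<noteq> (a < x))"
    using Cons.prems by (intro Cons.IH) (auto simp: c_def w_def u_def split: if_splits)
  moreover have "of_bool ((a < x) \<noteq> up') + of_bool (u \<noteq> (a < x))
      \<le> of_bool c + 2 * of_bool (x < a + k \<and> a < x + k) + (of_bool (up \<noteq> up') :: nat)"
    using Cons.prems by (cases up; cases up'; cases c) (auto simp: c_def u_def split: if_splits)
  ultimately show ?case unfolding g by simp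
qed auto

text \<open>An alternating subsequence cannot have more turns than the word itself. If its next move is opposite to
  the direction of the scan, then that move has to wait for a turn of the word, provided that the last chosen value
  \<open>b\<close> does not lie beyond the current letter \<open>a\<close>; if it agrees with the direction of the
  scan, one more element is possible. The two bounds feed each other in the induction.\<close>
lemma zigzag_le_turns:
  assumes "k \<ge> 1" "subseq ys xs" "zigzag k d (b # ys)"
  shows "d \<noteq> up \<Longrightarrow> (if up then b \<le> a else a \<le> b) \<Longrightarrow> length ys \<le> turns a up xs"
    and "d = up \<Longrightarrow> length ys \<le> Suc (turns a up xs)"
  using assms
proof (induction xs arbitrary: a b d up ys)
  case (Cons x xs)
  note IH = Cons.IH
  { case 1
    show ?case
    proof (cases "\<exists>zs. ys = x # zs \<and> subseq zs xs")
      case True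
      then obtain zs where zs: "ys = x # zs" "subseq zs xs" by blast
      have ne: "(a < x) \<noteq> up" and z: "zigzag k up (x # zs)"
        using 1 zs by (cases up; auto)+
      have "length zs \<le> turns x (\<not> up) xs" using IH(1)[of up "\<not> up" x x zs] z zs \<open>k \<ge> 1\<close> by auto
      thus ?thesis using ne zs by (cases up) auto
    next
      case False
      hence s: "subseq ys xs" using 1 by (cases ys) (auto split: if_splits elim: list_emb.cases)
      show ?thesis
      proof (cases "(a < x) = up")
        case True
        have "length ys \<le> turns x up xs" by (rule IH(1)[of d up b x ys]) (use 1 s True in \<open>auto split: if_splits\<close>)
        thus ?thesis using True by auto
      next
        case False
        have "length ys \<le> Suc (turns x (\<not> up) xs)"
          by (rule IH(2)[of d "\<not> up" ys b x]) (use 1 s False in auto)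
        thus ?thesis using False by (cases up) auto
      qed
    qed
  }
  { case 2
    show ?case
    proof (cases ys)
      case (Cons y zs)
      have z: "zigzag k (\<not> up) (y # zs)" using 2 Cons by (cases up) auto
      have s: "subseq zs xs" using 2 Cons by (auto split: if_splits elim: subseq_Cons')
      show ?thesis
      proof (cases "(a < x) = up")
        case True
        show ?thesis
        proof (cases "y = x")
          case T: True
          have "length zs \<le> turns x up xs" using IH(1)[of "\<not> up" up x x zs] z s T \<open>k \<ge> 1\<close> by auto
          thus ?thesis using True Cons by auto
        next
          case False
          hence "subseq ys xs" using 2 Cons by (auto elim: list_emb.cases)
          hence "length ys \<le> Suc (turns x up xs)" using IH(2)[of d up ys b x] 2 by auto
          thus ?thesis using True by auto
        qed
      next
        case False
        have "length zs \<le> Suc (turns x (\<not> up) xs)" using IH(2)[of "\<not> up" "\<not> up" zs y x] z s \<open>k \<ge> 1\<close> by auto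
        thus ?thesis using False Cons by (cases up) auto
      qed
    qed auto
  }
qed (auto dest: list_emb_Nil2)

lemma zigzag_iff_nth:
  "zigzag k up ys \<longleftrightarrow> (\<forall>j. Suc j < length ys \<longrightarrow>
     (if even j = up then ys ! j + k \<le> ys ! Suc j else ys ! Suc j + k \<le> ys ! j))"
proof (induction k up ys rule: zigzag.induct)
  case (1 k up x y ys)
  show ?case using 1 by (simp add: All_less_Suc2)
qed auto

lemma subseq_sorted_wrt: "subseq xs ys \<Longrightarrow> sorted_wrt P ys \<Longrightarrow> sorted_wrt P xs"
  by (induction rule: list_emb.induct) (auto dest: list_emb_set)

text \<open>Passing from index lists to subsequences of the word makes structural induction possible.\<close>
lemma zigzag_lengths:
  "{length is | is. k_alternating n k \<sigma> is} =
   {length ys | ys. subseq ys (map \<sigma> [1..<Suc n]) \<and> zigzag k False ys}"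
proof (intro set_eqI iffI; clarify)
  fix js assume "k_alternating n k \<sigma> js"
  hence js: "set js \<subseteq> {1..n}" "sorted_wrt (<) js" "zigzag k False (map \<sigma> js)"
    by (auto simp: k_alternating_def zigzag_iff_nth)
  have "filter (\<lambda>i. i \<in> set js) [1..<Suc n] = js"
    using js(1,2) by (intro sorted_distinct_set_unique)
      (auto simp: strict_sorted_iff simp del: upt_Suc intro: sorted_wrt_filter)
  hence "subseq js [1..<Suc n]" by (metis subseq_filter_left)
  thus "\<exists>ys. length js = length ys \<and> subseq ys (map \<sigma> [1..<Suc n]) \<and> zigzag k False ys"
    using js(3) subseq_map by (intro exI[of _ "map \<sigma> js"]) (auto simp del: upt_Suc)
next
  fix ys assume ys: "subseq ys (map \<sigma> [1..<Suc n])" "zigzag k False ys"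
  then obtain N where N: "ys = nths (map \<sigma> [1..<Suc n]) N" unfolding subseq_conv_nths by blast
  define js where "js = nths [1..<Suc n] N"
  have js: "ys = map \<sigma> js" using N by (simp only: js_def nths_map)
  have sub: "subseq js [1..<Suc n]" unfolding js_def subseq_conv_nths by (rule exI, rule refl)
  have "set js \<subseteq> {1..n}" using set_nths_subset[of "[1..<Suc n]" N] unfolding js_def by (simp only: set_upt) fastforce
  moreover have "sorted_wrt (<) js" using sub by (rule subseq_sorted_wrt) (simp del: upt_Suc)
  ultimately have "k_alternating n k \<sigma> js"
    using ys(2) js by (auto simp: k_alternating_def zigzag_iff_nth)
  thus "\<exists>is. length ys = length is \<and> k_alternating n k \<sigma> is" using js by auto
qed

lemma las_near_peaks:
  assumes "k \<ge> 1"
  shows "\<bar>real (las n k \<sigma>) - 2 * real (peaks (map \<sigma> [1..<Suc n]))\<bar>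
           \<le> 2 + 2 * real (close_pairs k (map \<sigma> [1..<Suc n]))"
proof (cases "map \<sigma> [1..<Suc n]")
  case Nil
  hence "n = 0" by (simp split: if_splits)
  thus ?thesis by (auto simp: las_def k_alternating_def)
next
  case (Cons x xs)
  let ?S = "{length ys | ys. subseq ys (x # xs) \<and> zigzag k False ys}"
  have S: "?S = {length is | is. k_alternating n k \<sigma> is}" using zigzag_lengths[of n k \<sigma>] Cons by simp
  have fin: "finite ?S" unfolding S by (rule finite_k_alternating_lengths)
  have las: "las n k \<sigma> = Max ?S" by (simp add: las_def S)
  obtain y ys where y: "subseq (y # ys) (x # xs)" "zigzag k (\<not> True) (y # ys)"
      "length ys = greedy k x True xs" using greedy_zigzag[of x xs k True] by (elim exE conjE)
  have "Suc (greedy k x True xs) \<in> ?S"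
    by (rule CollectI, rule exI[of _ "y # ys"]) (use y in simp)
  hence "Suc (greedy k x True xs) \<le> las n k \<sigma>" unfolding las using fin by simp
  moreover have "turns x True xs \<le> greedy k x True xs + 2 * close_pairs_from k x xs"
    using turns_le_greedy[of True x x k True xs] assms by simp
  moreover have "las n k \<sigma> \<le> turns x True xs + 3"
    unfolding las
  proof (rule Max.boundedI[OF fin])
    show "?S \<noteq> {}" unfolding S by (rule k_alternating_lengths_nonempty)
    fix m assume "m \<in> ?S"
    then obtain ys where ys: "m = length ys" "subseq ys (x # xs)" "zigzag k False ys" by auto
    show "m \<le> turns x True xs + 3"
    proof (cases ys rule: remdups_adj.cases)
      case (3 y y' zs)
      have "subseq (y' # zs) xs" using ys 3 by (auto split: if_splits elim: subseq_Cons')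
      hence "subseq zs xs" by (rule subseq_Cons')
      thus ?thesis using zigzag_le_turns(2)[of k zs xs True y' True x] ys 3 assms by auto
    qed (use ys in auto)
  qed
  moreover note peaks_turns[of x True xs]
  ultimately show ?thesis using Cons by auto
qed

section \<open>Averages over a finite set\<close>

definition average :: "'a set \<Rightarrow> ('a \<Rightarrow> 'b :: real_vector) \<Rightarrow> 'b" where
  "average A f = (\<Sum>x\<in>A. f x) /\<^sub>R real (card A)"

lemma average_mono:
  fixes f g :: "'a \<Rightarrow> real"
  assumes "\<And>x. x \<in> A \<Longrightarrow> f x \<le> g x"
  shows "average A f \<le> average A g"
  using assms by (simp add: average_def divideR_right divide_right_mono sum_mono mult_left_mono)

lemma average_cong: "(\<And>x. x \<in> A \<Longrightarrow> f x = g x) \<Longrightarrow> average A f = average A g"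
  by (simp add: average_def)

lemma average_add: "average A (\<lambda>x. f x + g x) = average A f + average A g"
  by (simp add: average_def sum.distrib scaleR_add_right)

lemma average_diff: "average A (\<lambda>x. f x - g x) = average A f - average A g"
  by (simp add: average_def sum_subtractf scaleR_diff_right)

lemma average_cmult: "average A (\<lambda>x. c * f x) = c * average A f" for c :: "'b :: real_algebra"
  by (simp add: average_def sum_distrib_left)

lemma average_const: "finite A \<Longrightarrow> A \<noteq> {} \<Longrightarrow> average A (\<lambda>x. c) = c"
  by (simp add: average_def scaleR_conv_of_real sum_constant_scaleR)

lemma norm_average_le: "norm (average A f) \<le> average A (\<lambda>x. norm (f x))"
  for f :: "'a \<Rightarrow> 'b :: real_normed_vector"
  by (simp add: average_def sum_norm_le mult_left_mono)

lemma average_center_sq: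
  fixes f :: "'a \<Rightarrow> real"
  assumes "finite A" "A \<noteq> {}"
  shows "average A (\<lambda>x. (f x - average A f)\<^sup>2) = average A (\<lambda>x. (f x)\<^sup>2) - (average A f)\<^sup>2"
proof -
  have "average A (\<lambda>x. (f x - average A f)\<^sup>2)
      = average A (\<lambda>x. ((f x)\<^sup>2 + (- 2 * average A f) * f x) + (average A f)\<^sup>2)"
    by (rule average_cong) (simp add: power2_eq_square algebra_simps)
  also have "\<dots> = average A (\<lambda>x. (f x)\<^sup>2) - (average A f)\<^sup>2"
    by (simp only: average_add average_cmult average_const[OF assms]) (simp add: power2_eq_square)
  finally show ?thesis .
qed

lemma average_power2_le:
  fixes f :: "'a \<Rightarrow> real"
  assumes "finite A" "A \<noteq> {}"
  shows "(average A f)\<^sup>2 \<le> average A (\<lambda>x. (f x)\<^sup>2)"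
proof -
  have "0 \<le> average A (\<lambda>x. (f x - average A f)\<^sup>2)"
    by (simp add: average_def sum_nonneg)
  thus ?thesis by (simp add: average_center_sq[OF assms])
qed

lemma average_abs_le:
  fixes f :: "'a \<Rightarrow> real"
  assumes "finite A" "A \<noteq> {}"
  shows "average A (\<lambda>x. \<bar>f x\<bar>) \<le> sqrt (average A (\<lambda>x. (f x)\<^sup>2))"
  using average_power2_le[OF assms, of "\<lambda>x. \<bar>f x\<bar>"] by (simp add: real_le_rsqrt)

definition rms :: "'a set \<Rightarrow> ('a \<Rightarrow> real) \<Rightarrow> real" where
  "rms A f = sqrt (average A (\<lambda>x. (f x)\<^sup>2))"

lemma rms_L2_set: "rms A f = L2_set f A / sqrt (card A)"
  by (simp add: rms_def average_def L2_set_def real_sqrt_mult real_sqrt_inverse divide_inverse mult.commute)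

lemma rms_add_le: "rms A (\<lambda>x. f x + g x) \<le> rms A f + rms A g"
  using L2_set_triangle_ineq[of f g A]
  by (simp add: rms_L2_set add_divide_distrib[symmetric] divide_right_mono)

lemma rms_cmult: "rms A (\<lambda>x. c * f x) = \<bar>c\<bar> * rms A f"
  by (simp add: rms_def power_mult_distrib average_cmult real_sqrt_mult)

lemma rms_mono:
  assumes "\<And>x. x \<in> A \<Longrightarrow> \<bar>f x\<bar> \<le> g x"
  shows "rms A f \<le> rms A g"
  unfolding rms_def using assms
  by (intro real_sqrt_le_mono average_mono) (metis abs_ge_zero power2_abs power_mono)

lemma rms_center_le:
  assumes "finite A" "A \<noteq> {}"
  shows "rms A (\<lambda>x. f x - average A f) \<le> rms A f"
  by (simp add: rms_def average_center_sq[OF assms])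

definition std_dev :: "'a set \<Rightarrow> ('a \<Rightarrow> real) \<Rightarrow> real" where
  "std_dev A f = rms A (\<lambda>x. f x - average A f)"

text \<open>Standard deviation is a seminorm bounded by the root mean square.\<close>
lemma std_dev_le:
  assumes "finite A" "A \<noteq> {}"
  shows "std_dev A f \<le> std_dev A g + rms A (\<lambda>x. f x - g x)"
proof -
  have "std_dev A f = rms A (\<lambda>x. (g x - average A g) + ((f x - g x) - average A (\<lambda>x. f x - g x)))"
    unfolding std_dev_def by (simp add: average_diff algebra_simps)
  also have "\<dots> \<le> std_dev A g + rms A (\<lambda>x. (f x - g x) - average A (\<lambda>x. f x - g x))"
    unfolding std_dev_def by (rule rms_add_le)
  also have "\<dots> \<le> std_dev A g + rms A (\<lambda>x. f x - g x)"
    using rms_center_le[OF assms, of "\<lambda>x. f x - g x"] by simp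
  finally show ?thesis .
qed

text \<open>Standardizing each statistic by its own mean and deviation is harmless: the centred difference contributes
  \<open>r / std_dev A f\<close>, where \<open>r\<close> is the root mean square of \<open>f - g\<close>, and
  exchanging one deviation for the other contributes the same amount again, because the deviations differ by at most
  \<open>r\<close>.\<close>
lemma standardized_near:
  assumes A: "finite A" "A \<noteq> {}" and "std_dev A f > 0" "std_dev A g > 0"
  shows "average A (\<lambda>x. \<bar>(f x - average A f) / std_dev A f - (g x - average A g) / std_dev A g\<bar>)
    \<le> 2 * rms A (\<lambda>x. f x - g x) / std_dev A f"
proof -
  define a b r where "a = std_dev A f" "b = std_dev A g" "r = rms A (\<lambda>x. f x - g x)"
  note [simp] = this[symmetric]
  have pos: "a > 0" "b > 0" using assms by simp_all
  have "rms A (\<lambda>x. g x - f x) = r" using rms_cmult[of A "-1" "\<lambda>x. f x - g x"] by simp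
  hence ab: "\<bar>b - a\<bar> \<le> r"
    using std_dev_le[OF A, of f g] std_dev_le[OF A, of g f] by simp
  let ?d = "\<lambda>x. (f x - g x) - average A (\<lambda>x. f x - g x)"
  have "average A (\<lambda>x. \<bar>(f x - average A f) / a - (g x - average A g) / b\<bar>)
     \<le> rms A (\<lambda>x. (f x - average A f) / a - (g x - average A g) / b)"
    unfolding rms_def by (rule average_abs_le[OF A])
  also have "\<dots> = rms A (\<lambda>x. (1 / a) * ?d x + (1 / a - 1 / b) * (g x - average A g))"
  proof -
    have "(f x - average A f) / a - (g x - average A g) / b = (1 / a) * ?d x + (1 / a - 1 / b) * (g x - average A g)" for x
      using pos by (simp add: average_diff field_simps)
    thus ?thesis by simp
  qed
  also have "\<dots> \<le> rms A (\<lambda>x. (1 / a) * ?d x) + rms A (\<lambda>x. (1 / a - 1 / b) * (g x - average A g))"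
    by (rule rms_add_le)
  also have "\<dots> = (1 / a) * rms A ?d + \<bar>1 / a - 1 / b\<bar> * b"
    unfolding rms_cmult using pos by (simp flip: std_dev_def)
  also have "\<bar>1 / a - 1 / b\<bar> * b = \<bar>b - a\<bar> / a"
  proof -
    have "1 / a - 1 / b = (b - a) / (a * b)" using pos by (simp add: field_simps)
    thus ?thesis using pos by (simp add: abs_mult)
  qed
  also have "(1 / a) * rms A ?d + \<bar>b - a\<bar> / a \<le> (1 / a) * r + r / a"
    using pos ab rms_center_le[OF A, of "\<lambda>x. f x - g x"]
    by (intro add_mono mult_left_mono divide_right_mono) auto
  finally show ?thesis by simp
qed

section \<open>Inserting the largest letter\<close>

definition insert_at :: "nat \<Rightarrow> 'a \<Rightarrow> 'a list \<Rightarrow> 'a list" where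
  "insert_at j y xs = take j xs @ y # drop j xs"

lemma insert_at_simps [simp]:
  "insert_at 0 y xs = y # xs"
  "insert_at (Suc j) y (x # xs) = x # insert_at j y xs"
  by (simp_all add: insert_at_def)

lemma peaks_from_True:
  "peaks_from a True xs = peaks_from a False xs + of_bool (xs = [] \<or> \<not> a < hd xs)"
  by (cases xs) auto

text \<open>The number \<open>c\<close> counts the gaps after \<open>a\<close> that touch a peak: every peak touches
  two gaps, and no two peaks are adjacent, but the gap in front of \<open>a\<close> is not among those considered,
  which accounts for the correction if \<open>a\<close> itself is a peak.\<close>
lemma sum_peaks_from_insert:
  fixes h :: "nat \<Rightarrow> 'b :: real_vector" and up :: bool
  assumes "distinct (a # xs)" "\<And>y. y \<in> set (a # xs) \<Longrightarrow> y < N"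
  defines "c \<equiv> real (2 * peaks_from a up xs) - of_bool (up \<and> (xs = [] \<or> \<not> a < hd xs))"
  shows "(\<Sum>j\<le>length xs. h (peaks_from a up (insert_at j N xs)))
    = c *\<^sub>R h (peaks_from a up xs) + (real (Suc (length xs)) - c) *\<^sub>R h (Suc (peaks_from a up xs))"
  using assms(1,2) unfolding c_def
proof (induction xs arbitrary: a up h)
  case Nil
  thus ?case by (cases up) (auto simp: scaleR_2)
next
  case (Cons x xs)
  define e :: nat where "e = of_bool (up \<and> \<not> a < x)"
  have IH: "(\<Sum>j\<le>length xs. h (e + peaks_from x (a < x) (insert_at j N xs)))
    = (real (2 * peaks_from x (a < x) xs) - of_bool ((a < x) \<and> (xs = [] \<or> \<not> x < hd xs)))
        *\<^sub>R h (e + peaks_from x (a < x) xs)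
     + (real (Suc (length xs)) - (real (2 * peaks_from x (a < x) xs) - of_bool ((a < x) \<and> (xs = [] \<or> \<not> x < hd xs))))
        *\<^sub>R h (e + Suc (peaks_from x (a < x) xs))"
    by (rule Cons.IH) (use Cons.prems in auto)
  have N: "a < N" "x < N" "x \<noteq> a" using Cons.prems by auto
  show ?case
    unfolding length_Cons sum.atMost_Suc_shift
    using IH N peaks_from_True[of x xs] unfolding e_def
    by (cases "a < x"; cases up; cases "xs = [] \<or> \<not> x < hd xs")
       (auto simp: algebra_simps scaleR_add_left scaleR_2)
qed

text \<open>The transition rule of the Markov chain: of all gaps, exactly \<open>2p\<close> leave the number of peaks
  unchanged.\<close>
lemma sum_peaks_insert:
  fixes h :: "nat \<Rightarrow> 'b :: real_vector"
  assumes "distinct xs" "\<And>y. y \<in> set xs \<Longrightarrow> y < N" "xs \<noteq> []"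
  defines "p \<equiv> peaks xs"
  shows "(\<Sum>j\<le>length xs. h (peaks (insert_at j N xs)))
    = real (2 * p) *\<^sub>R h p + (real (Suc (length xs)) - real (2 * p)) *\<^sub>R h (Suc p)"
proof (cases xs)
  case (Cons x ys)
  have N: "x < N" using assms Cons by auto
  have S: "(\<Sum>j\<le>length ys. h (peaks_from x True (insert_at j N ys)))
    = (real (2 * peaks_from x True ys) - of_bool (ys = [] \<or> \<not> x < hd ys)) *\<^sub>R h (peaks_from x True ys)
     + (real (Suc (length ys)) - (real (2 * peaks_from x True ys) - of_bool (ys = [] \<or> \<not> x < hd ys)))
        *\<^sub>R h (Suc (peaks_from x True ys))"
    using sum_peaks_from_insert[of x ys N h True] assms Cons by simp
  show ?thesis unfolding p_def Cons length_Cons sum.atMost_Suc_shift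
    using S N peaks_from_True[of x ys]
    by (cases "ys = [] \<or> \<not> x < hd ys") (auto simp: algebra_simps scaleR_add_left scaleR_2)
qed (use assms in simp)

text \<open>No two adjacent letters are both peaks. This makes \<open>2p/(n+1)\<close> a probability.\<close>
lemma two_peaks_le: "2 * peaks xs \<le> Suc (length xs)"
proof -
  have t: "turns a up xs \<le> length xs" for a up xs by (induction xs arbitrary: a up) (auto simp: le_SucI less_Suc_eq_le)
  show ?thesis
  proof (cases xs)
    case (Cons x ys) thus ?thesis using peaks_turns(2)[of x True ys] t[of x True ys] by simp
  qed simp
qed

text \<open>The letters that form a close pair with an inserted largest letter \<open>N\<close>.\<close>
definition near :: "nat \<Rightarrow> nat \<Rightarrow> nat list \<Rightarrow> nat" where
  "near k N xs = length (filter (\<lambda>y. N < y + k) xs)"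

lemma near_simps [simp]: "near k N [] = 0" "near k N (x # xs) = of_bool (N < x + k) + near k N xs"
  by (auto simp: near_def)

lemma near_le:
  assumes "distinct xs" "\<And>y. y \<in> set xs \<Longrightarrow> y < N"
  shows "near k N xs \<le> k"
proof -
  have "near k N xs = card {y \<in> set xs. N < y + k}"
    using assms(1) by (simp add: near_def distinct_card[symmetric] distinct_filter)
  also have "\<dots> \<le> card {N - k..<N}" using assms(2) by (intro card_mono) auto
  also have "\<dots> \<le> k" by simp
  finally show ?thesis .
qed

text \<open>An insertion changes the number of close pairs by \<open>Y - X\<close>, where \<open>X \<in> {0,
  1}\<close> tells whether the chosen gap was a close pair and \<open>Y \<le> 2\<close> counts the letters near
  \<open>N\<close> beside the gap. Over all gaps these sum to \<open>b\<close> and \<open>m\<close>, and \<open>(Y -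
  X)\<^sup>2 \<le> X + 2 Y\<close>. The offset \<open>c\<close> stands for the close pairs to the left of
  \<open>a\<close> and is what makes the second bound inductive.\<close>
lemma sum_close_pairs_from_insert:
  fixes c :: real and k N :: nat
  assumes "\<And>y. y \<in> set (a # xs) \<Longrightarrow> y < N"
  defines "b \<equiv> real (close_pairs_from k a xs)"
  defines "m \<equiv> real (of_bool (N < a + k) + 2 * near k N xs)"
  shows "(\<Sum>j\<le>length xs. real (close_pairs_from k a (insert_at j N xs))) = real (length xs) * b + m
    \<and> (\<Sum>j\<le>length xs. (c + real (close_pairs_from k a (insert_at j N xs)))\<^sup>2)
      \<le> real (Suc (length xs)) * (c + b)\<^sup>2 + 2 * (c + b) * (m - b) + b + 2 * m"
  using assms(1) unfolding b_def m_def
proof (induction xs arbitrary: a c)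
  case Nil
  thus ?case by (auto simp: power2_eq_square algebra_simps)
next
  case (Cons x xs)
  have N: "a < N" "x < N" using Cons.prems by auto
  define X :: real where "X = of_bool (x < a + k \<and> a < x + k)"
  define Y :: real where "Y = of_bool (N < a + k) + of_bool (N < x + k)"
  define b' where "b' = real (close_pairs_from k x xs)"
  define m' where "m' = real (of_bool (N < x + k) + 2 * near k N xs)"
  \<comment> \<open>The first gap lies between \<open>a\<close> and \<open>x\<close>; it is split off, and the offset absorbs \<open>X\<close> for the rest.\<close>
  have 0: "real (close_pairs_from k a (N # x # xs)) = Y + b'" using N by (auto simp: Y_def b'_def)
  have b: "real (close_pairs_from k a (x # xs)) = X + b'" by (auto simp: X_def b'_def)
  have m: "real (of_bool (N < a + k) + 2 * near k N (x # xs)) = Y + m'" by (auto simp: Y_def m'_def)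
  have s: "real (close_pairs_from k a (x # insert_at j N xs)) = X + real (close_pairs_from k x (insert_at j N xs))" for j
    by (auto simp: X_def)
  note e = length_Cons sum.atMost_Suc_shift insert_at_simps 0 b m s
  have XY: "X\<^sup>2 + Y\<^sup>2 - 2 * X * Y \<le> X + 2 * Y" by (auto simp: X_def Y_def)
  have "(\<Sum>j\<le>length xs. real (close_pairs_from k x (insert_at j N xs))) = real (length xs) * b' + m'"
    and "(\<Sum>j\<le>length xs. (c + X + real (close_pairs_from k x (insert_at j N xs)))\<^sup>2)
       \<le> real (Suc (length xs)) * (c + X + b')\<^sup>2 + 2 * (c + X + b') * (m' - b') + b' + 2 * m'"
    using Cons.IH[of x "c + X"] Cons.prems unfolding b'_def m'_def by auto
  thus ?case unfolding e sum.distrib using XY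
    by (auto simp: algebra_simps power2_eq_square)
qed

text \<open>The gap in front of the first letter is added to the previous count; then every letter near
  \<open>N\<close> touches exactly two gaps, and there are at most \<open>k\<close> such letters.\<close>
lemma sum_close_pairs_insert:
  fixes k :: nat and b :: real
  assumes "distinct xs" "\<And>y. y \<in> set xs \<Longrightarrow> y < N" "xs \<noteq> []"
  defines "b \<equiv> real (close_pairs k xs)"
  shows "(\<Sum>j\<le>length xs. real (close_pairs k (insert_at j N xs))) \<le> real (length xs) * b + 2 * k"
    and "(\<Sum>j\<le>length xs. (real (close_pairs k (insert_at j N xs)))\<^sup>2)
      \<le> (real (length xs) - 1) * b\<^sup>2 + (4 * k + 1) * b + 4 * k"
proof -
  obtain x ys where xs: "xs = x # ys" using assms(3) by (cases xs) auto
  have N: "x < N" using assms xs by auto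
  define e :: real where "e = of_bool (N < x + k)"
  have c0: "real (close_pairs k (N # xs)) = e + b" using N by (auto simp: e_def b_def xs)
  define m where "m = real (of_bool (N < x + k) + 2 * near k N ys)"
  have m: "m + e = 2 * real (near k N xs)" by (auto simp: xs m_def e_def)
  have mk: "m + e \<le> 2 * k" unfolding m using near_le[of xs N k] assms by simp
  have e: "e * e \<le> 2 * e" by (auto simp: e_def)
  have b0: "b \<ge> 0" by (simp add: b_def)
  have b: "real (close_pairs_from k x ys) = b" by (simp add: b_def xs)
  have split: "(\<Sum>j\<le>length xs. f (real (close_pairs k (insert_at j N xs))))
      = f (e + b) + (\<Sum>j\<le>length ys. f (real (close_pairs_from k x (insert_at j N ys))))" for f :: "real \<Rightarrow> real"
    unfolding c0[symmetric] by (simp add: xs sum.atMost_Suc_shift del: sum.atMost_Suc)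
  show "(\<Sum>j\<le>length xs. real (close_pairs k (insert_at j N xs))) \<le> real (length xs) * b + 2 * k"
    using sum_close_pairs_from_insert[of x ys N k 0] assms split[of "\<lambda>x. x"] mk
    unfolding b m_def[symmetric] by (simp add: xs algebra_simps)
  have "(\<Sum>j\<le>length xs. (real (close_pairs k (insert_at j N xs)))\<^sup>2)
     \<le> (e + b)\<^sup>2 + (real (length xs) * b\<^sup>2 + 2 * b * (m - b) + b + 2 * m)"
    using sum_close_pairs_from_insert[of x ys N k 0] assms split[of "\<lambda>x. x\<^sup>2"]
    unfolding b m_def[symmetric] by (simp add: xs)
  also have "\<dots> \<le> (real (length xs) - 1) * b\<^sup>2 + 2 * b * (m + e) + b + 2 * (m + e)"
    using e by (simp add: power2_eq_square algebra_simps)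
  also have "\<dots> \<le> (real (length xs) - 1) * b\<^sup>2 + 2 * b * (2 * k) + b + 2 * (2 * k)"
    using mk b0 by (intro add_mono mult_left_mono) (auto simp: xs)
  finally show "(\<Sum>j\<le>length xs. (real (close_pairs k (insert_at j N xs)))\<^sup>2)
      \<le> (real (length xs) - 1) * b\<^sup>2 + (4 * k + 1) * b + 4 * k" by (simp add: algebra_simps)
qed

abbreviation perms :: "nat \<Rightarrow> nat list set" where
  "perms n \<equiv> permutations_of_set {1..n}"

lemma permsD:
  assumes "xs \<in> perms n"
  shows "distinct xs" "length xs = n" "\<And>y. y \<in> set xs \<Longrightarrow> y < Suc n" "set xs = {1..n}"
  using permutations_of_setD[OF assms] distinct_card[of xs] by auto

lemma bij_insert_at:
  "bij_betw (\<lambda>(xs, j). insert_at j (Suc n) xs) (perms n \<times> {..n}) (perms (Suc n))"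
proof -
  let ?f = "\<lambda>(xs, j). insert_at j (Suc n) xs"
  have inj: "inj_on ?f (perms n \<times> {..n})"
  proof (rule inj_onI, clarsimp)
    fix xs i ys j assume h: "xs \<in> permutations_of_set {Suc 0..n}" "i \<le> n" "ys \<in> permutations_of_set {Suc 0..n}" "j \<le> n"
      "insert_at i (Suc n) xs = insert_at j (Suc n) ys"
    have "xs \<in> perms n" "ys \<in> perms n" using h by auto
    note x = permsD[OF this(1)] permsD[OF this(2)]
    have "Suc n \<notin> set (take i xs)" "Suc n \<notin> set (take j ys)" 
      "Suc n \<notin> set xs" "Suc n \<notin> set ys"
      using x(3,7) by (auto dest: in_set_takeD)
    hence e: "take i xs = take j ys \<and> drop i xs = drop j ys"
      using h(5) unfolding insert_at_def
      by (subst (asm) append_Cons_eq_iff) (auto dest: in_set_dropD)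
    hence "i = j" using x h by (metis length_take min.absorb2)
    thus "xs = ys \<and> i = j" using e by (metis append_take_drop_id)
  qed
  have sub: "?f ` (perms n \<times> {..n}) \<subseteq> perms (Suc n)"
  proof clarify
    fix xs j assume "xs \<in> perms n"
    note x = permsD[OF this]
    have "set (take j xs) \<union> set (drop j xs) = {1..n}" using x(4) by (simp flip: set_append)
    moreover have "set (insert_at j (Suc n) xs) = insert (Suc n) (set (take j xs) \<union> set (drop j xs))"
      unfolding insert_at_def by (simp only: set_append list.set) blast
    ultimately have s: "set (insert_at j (Suc n) xs) = {1..Suc n}" by (simp only: atLeastAtMostSuc_conv)
    have "distinct (take j xs @ drop j xs)" using x(1) by simp
    moreover have "set (take j xs) \<inter> set (drop j xs) = {}"
      using x(1) by (rule set_take_disj_set_drop_if_distinct) simp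
    moreover have "Suc n \<notin> set xs" using x(3) by blast
    ultimately have "distinct (insert_at j (Suc n) xs)"
      unfolding insert_at_def by (auto dest: in_set_takeD in_set_dropD)
    thus "insert_at j (Suc n) xs \<in> perms (Suc n)" using s by (intro permutations_of_setI)
  qed
  have "card (?f ` (perms n \<times> {..n})) = card (perms (Suc n))"
    using card_image[OF inj] by (simp add: card_cartesian_product)
  with sub have "?f ` (perms n \<times> {..n}) = perms (Suc n)" by (intro card_subset_eq) auto
  with inj show ?thesis by (simp add: bij_betw_def)
qed

text \<open>Averaging over the permutations of size \<open>n + 1\<close> is averaging over those of size
  \<open>n\<close> and then over the gap that receives the new largest letter.\<close>
lemma average_perms_Suc:
  fixes f :: "nat list \<Rightarrow> 'b :: real_vector"
  shows "average (perms (Suc n)) f = average (perms n) (\<lambda>xs. (\<Sum>j\<le>n. f (insert_at j (Suc n) xs)) /\<^sub>R real (Suc n))"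
proof -
  have "(\<Sum>x\<in>perms (Suc n). f x) = (\<Sum>(xs, j)\<in>perms n \<times> {..n}. f (insert_at j (Suc n) xs))"
    using sum.reindex_bij_betw[OF bij_insert_at[of n], of f] by (simp add: case_prod_unfold)
  also have "\<dots> = (\<Sum>xs\<in>perms n. \<Sum>j\<le>n. f (insert_at j (Suc n) xs))"
    by (simp add: sum.cartesian_product)
  finally have s: "(\<Sum>x\<in>perms (Suc n). f x) = (\<Sum>xs\<in>perms n. \<Sum>j\<le>n. f (insert_at j (Suc n) xs))" .
  have c: "real (card (perms (Suc n))) = real (Suc n) * real (card (perms n))" by (simp add: algebra_simps)
  show ?thesis unfolding average_def c s scaleR_sum_right[symmetric]
    by (simp add: mult.commute del: of_nat_Suc card_permutations_of_set)
qed

text \<open>The losses, proportional to the current number of close pairs, balance the gains at a level that does not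
  depend on \<open>n\<close>; the bounds are the fixed points of the two recursions.\<close>
lemma average_close_pairs:
  shows "average (perms n) (\<lambda>xs. real (close_pairs k xs)) \<le> 2 * k"
    and "average (perms n) (\<lambda>xs. (real (close_pairs k xs))\<^sup>2) \<le> 4 * k\<^sup>2 + 3 * k"
proof (induction n)
  case 0
  { case 1 show ?case by (simp add: average_def) }
  { case 2 show ?case by (simp add: average_def) }
next
  case (Suc n)
  have base: "close_pairs k xs = 0" if "n = 0" "xs \<in> perms (Suc n)" for xs using that by auto
  { case 1
    show ?case
    proof (cases "n = 0")
      case True
      thus ?thesis using base by (simp add: average_def)
    next
      case False
      have "average (perms (Suc n)) (\<lambda>xs. real (close_pairs k xs))
         \<le> average (perms n) (\<lambda>xs. (real n / real (Suc n)) * real (close_pairs k xs) + 2 * k / real (Suc n))"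
        unfolding average_perms_Suc
      proof (rule average_mono)
        fix xs assume "xs \<in> perms n"
        note x = permsD[OF this]
        have "(\<Sum>j\<le>n. real (close_pairs k (insert_at j (Suc n) xs))) \<le> n * real (close_pairs k xs) + 2 * k"
          using sum_close_pairs_insert(1)[of xs "Suc n" k] x False by force
        from divide_right_mono[OF this, of "real (Suc n)"] show "(\<Sum>j\<le>n. real (close_pairs k (insert_at j (Suc n) xs))) /\<^sub>R real (Suc n) \<le> (real n / real (Suc n)) * real (close_pairs k xs) + 2 * k / real (Suc n)"
          by (simp add: add_divide_distrib divide_inverse algebra_simps del: of_nat_Suc)
      qed
      also have "\<dots> = (real n / real (Suc n)) * average (perms n) (\<lambda>xs. real (close_pairs k xs)) + 2 * k / real (Suc n)"
        by (simp only: average_add average_cmult) (simp add: average_const)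
      also have "\<dots> \<le> (real n / real (Suc n)) * (2 * k) + 2 * k / real (Suc n)"
        using Suc(1) by (intro add_right_mono mult_left_mono) auto
      also have "\<dots> = 2 * k"
      proof -
        have "(M - 1) / M * (2 * k) + 2 * k / M = 2 * k" if "M > 0" for M :: real
          using that by (simp add: field_simps)
        from this[of "real (Suc n)"] show ?thesis by simp
      qed
      finally show ?thesis .
    qed
  }
  { case 2
    show ?case
    proof (cases "n = 0")
      case True
      thus ?thesis using base by (simp add: average_def)
    next
      case False
      define B :: real where "B = 4 * k\<^sup>2 + 3 * k"
      have "average (perms (Suc n)) (\<lambda>xs. (real (close_pairs k xs))\<^sup>2)
         \<le> average (perms n) (\<lambda>xs. ((real n - 1) / real (Suc n)) * (real (close_pairs k xs))\<^sup>2
            + ((4 * k + 1) / real (Suc n) * real (close_pairs k xs) + 4 * k / real (Suc n)))"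
        unfolding average_perms_Suc
      proof (rule average_mono)
        fix xs assume "xs \<in> perms n"
        note x = permsD[OF this]
        have "(\<Sum>j\<le>n. (real (close_pairs k (insert_at j (Suc n) xs)))\<^sup>2)
            \<le> (real n - 1) * (real (close_pairs k xs))\<^sup>2 + (4 * k + 1) * real (close_pairs k xs) + 4 * k"
          using sum_close_pairs_insert(2)[of xs "Suc n" k] x False by force
        from divide_right_mono[OF this, of "real (Suc n)"] show "(\<Sum>j\<le>n. (real (close_pairs k (insert_at j (Suc n) xs)))\<^sup>2) /\<^sub>R real (Suc n)
            \<le> ((real n - 1) / real (Suc n)) * (real (close_pairs k xs))\<^sup>2
            + ((4 * k + 1) / real (Suc n) * real (close_pairs k xs) + 4 * k / real (Suc n))"
          by (simp add: add_divide_distrib divide_inverse algebra_simps del: of_nat_Suc)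
      qed
      also have "\<dots> = ((real n - 1) / real (Suc n)) * average (perms n) (\<lambda>xs. (real (close_pairs k xs))\<^sup>2)
            + ((4 * k + 1) / real (Suc n) * average (perms n) (\<lambda>xs. real (close_pairs k xs)) + 4 * k / real (Suc n))"
        by (simp only: average_add average_cmult) (simp add: average_const)
      also have "\<dots> \<le> ((real n - 1) / real (Suc n)) * B + ((4 * k + 1) / real (Suc n) * (2 * k) + 4 * k / real (Suc n))"
        using Suc False unfolding B_def by (intro add_right_mono add_mono mult_left_mono) (auto simp: divide_simps)
      also have "\<dots> = B"
      proof -
        have "(M - 2) / M * B + ((4 * k + 1) / M * (2 * k) + 4 * k / M) = B" if "M > 0" for M :: real
          using that by (simp add: field_simps B_def power2_eq_square)
        from this[of "real (Suc n)"] show ?thesis by simp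
      qed
      finally show ?thesis unfolding B_def .
    qed
  }
qed

lemma average_peaks_Suc:
  fixes h :: "nat \<Rightarrow> 'b :: real_vector"
  assumes "n \<ge> 1"
  shows "average (perms (Suc n)) (\<lambda>xs. h (peaks xs)) = average (perms n) (\<lambda>xs.
     (2 * peaks xs / Suc n) *\<^sub>R h (peaks xs) + (1 - 2 * peaks xs / Suc n) *\<^sub>R h (Suc (peaks xs)))"
  unfolding average_perms_Suc
proof (rule average_cong)
  fix xs assume "xs \<in> perms n"
  note x = permsD[OF this]
  have s: "(\<Sum>j\<le>n. h (peaks (insert_at j (Suc n) xs))) =
     real (2 * peaks xs) *\<^sub>R h (peaks xs) + (real (Suc n) - real (2 * peaks xs)) *\<^sub>R h (Suc (peaks xs))"
    using sum_peaks_insert[OF x(1,3), of h] x(2) assms by (cases "xs = []") simp_all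
  have "1 - 2 * peaks xs / Suc n = inverse (real (Suc n)) * (real (Suc n) - real (2 * peaks xs))"
    by (simp add: field_simps del: of_nat_Suc)
  thus "(\<Sum>j\<le>n. h (peaks (insert_at j (Suc n) xs))) /\<^sub>R real (Suc n) =
     (2 * peaks xs / Suc n) *\<^sub>R h (peaks xs) + (1 - 2 * peaks xs / Suc n) *\<^sub>R h (Suc (peaks xs))"
    by (simp only: s scaleR_add_right scaleR_scaleR divide_inverse mult.commute)
qed

section \<open>Central limit theorem for the number of peaks\<close>

abbreviation peak_dev :: "nat \<Rightarrow> nat list \<Rightarrow> real" where
  "peak_dev n xs \<equiv> real (peaks xs) - real (n + 1) / 3"

lemma average_peaks_2:
  fixes h :: "nat \<Rightarrow> 'b :: real_vector"
  shows "average (perms 2) (\<lambda>xs. h (peaks xs)) = h 1"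
  using average_peaks_Suc[of 1 h] by (simp add: average_def numeral_2_eq_2)

lemma average_peak_dev:
  assumes "n \<ge> 2"
  shows "average (perms n) (peak_dev n) = 0"
  using assms
proof (induction n rule: dec_induct)
  case base
  show ?case using average_peaks_2[of "\<lambda>p. real p - real (2 + 1) / 3"] by simp
next
  case (step n)
  define M where "M = real (Suc n)"
  have M: "M > 0" "M \<noteq> 0" "real n = M - 1" by (auto simp: M_def)
  have "average (perms (Suc n)) (peak_dev (Suc n)) = average (perms n) (\<lambda>xs. (1 - 2 / M) * peak_dev n xs)"
    using step.hyps by (subst average_peaks_Suc[of n "\<lambda>p. real p - real (Suc n + 1) / 3"])
      (auto intro!: average_cong simp: M field_simps simp flip: M_def)
  also have "\<dots> = 0" using step.IH by (simp add: average_cmult)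
  finally show ?case .
qed

lemma average_peak_dev_sq_Suc:
  assumes "n \<ge> 2"
  shows "average (perms (Suc n)) (\<lambda>xs. (peak_dev (Suc n) xs)\<^sup>2)
    = (1 - 4 / Suc n) * average (perms n) (\<lambda>xs. (peak_dev n xs)\<^sup>2) + 2 / 9"
proof -
  define M where "M = real (Suc n)"
  have M: "M > 0" "M \<noteq> 0" "real n = M - 1" by (auto simp: M_def)
  have "average (perms (Suc n)) (\<lambda>xs. (peak_dev (Suc n) xs)\<^sup>2)
     = average (perms n) (\<lambda>xs. (1 - 4 / M) * (peak_dev n xs)\<^sup>2 + ((- 2 / (3 * M)) * peak_dev n xs + 2 / 9))"
    using assms by (subst average_peaks_Suc[of n "\<lambda>p. (real p - real (Suc n + 1) / 3)\<^sup>2"])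
      (auto intro!: average_cong simp: M field_simps power2_eq_square simp flip: M_def)
  also have "\<dots> = (1 - 4 / M) * average (perms n) (\<lambda>xs. (peak_dev n xs)\<^sup>2) + 2 / 9"
    using average_peak_dev[OF assms] by (simp only: average_add average_cmult) (simp add: average_const)
  finally show ?thesis by (simp add: M_def)
qed

text \<open>In the step from size 3 to size 4 the factor of the variance recursion vanishes, so the initial values are
  forgotten and the solution is exactly linear from there on.\<close>
lemma average_peak_dev_sq:
  assumes "n \<ge> 4"
  shows "average (perms n) (\<lambda>xs. (peak_dev n xs)\<^sup>2) = 2 * real (n + 1) / 45"
  using assms
proof (induction n rule: dec_induct)
  case base
  show ?case using average_peak_dev_sq_Suc[of 3] by (simp add: numeral_eq_Suc)
next
  case (step n)
  thus ?case by (subst average_peak_dev_sq_Suc) (auto simp: field_simps)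
qed

lemma average_peak_dev_sq_le:
  assumes "n \<ge> 2"
  shows "average (perms n) (\<lambda>xs. (peak_dev n xs)\<^sup>2) \<le> n"
proof -
  consider "n = 2" | "n = 3" | "n \<ge> 4" using assms by linarith
  thus ?thesis
  proof cases
    case 1
    thus ?thesis using average_peaks_2[of "\<lambda>p. (real p - real (2 + 1) / 3)\<^sup>2"] by simp
  next
    case 2
    have "average (perms 2) (\<lambda>xs. (peak_dev 2 xs)\<^sup>2) = 0"
      using average_peaks_2[of "\<lambda>p. (real p - real (2 + 1) / 3)\<^sup>2"] by simp
    thus ?thesis using average_peak_dev_sq_Suc[of 2] 2 by (simp add: numeral_3_eq_3)
  next
    case 3
    thus ?thesis using average_peak_dev_sq[OF 3] by simp
  qed
qed

text \<open>A second-order expansion of the characteristic function of a centred Bernoulli variable, whose variance is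
  \<open>q (1 - q)\<close>.\<close>
lemma bernoulli_iexp_approx:
  fixes q s :: real
  assumes "0 \<le> q" "q \<le> 1"
  shows "cmod (q * iexp (s * (q - 1)) + (1 - q) * iexp (s * q) - (1 - s\<^sup>2 * (q * (1 - q)) / 2)) \<le> \<bar>s\<bar> ^ 3"
proof -
  define T where "T = (\<lambda>x::real. 1 + \<i> * x - x\<^sup>2 / 2)"
  have T: "cmod (iexp x - T x) \<le> \<bar>x\<bar> ^ 3" for x
  proof -
    have "cmod (iexp x - T x) \<le> \<bar>x\<bar> ^ 3 / 6"
      using iexp_approx1[of x 2] by (simp add: T_def numeral_eq_Suc field_simps power2_eq_square)
    also have "\<dots> \<le> \<bar>x\<bar> ^ 3" by simp
    finally show ?thesis .
  qed
  have "q * iexp (s * (q - 1)) + (1 - q) * iexp (s * q) - (1 - s\<^sup>2 * (q * (1 - q)) / 2)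
     = q * (iexp (s * (q - 1)) - T (s * (q - 1))) + (1 - q) * (iexp (s * q) - T (s * q))"
    by (simp add: T_def power2_eq_square field_simps)
  also have "cmod \<dots> \<le> q * cmod (iexp (s * (q - 1)) - T (s * (q - 1))) + (1 - q) * cmod (iexp (s * q) - T (s * q))"
    by (rule norm_triangle_le) (use assms in \<open>simp only: norm_mult norm_of_real abs_of_nonneg diff_ge_0_iff_ge order_refl\<close>)
  also have "\<dots> \<le> q * \<bar>s\<bar> ^ 3 + (1 - q) * \<bar>s\<bar> ^ 3"
  proof (intro add_mono mult_left_mono)
    have "\<bar>s * (q - 1)\<bar> ^ 3 \<le> \<bar>s\<bar> ^ 3" "\<bar>s * q\<bar> ^ 3 \<le> \<bar>s\<bar> ^ 3"
      using assms by (auto intro!: power_mono mult_left_le simp: abs_mult)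
    thus "cmod (iexp (s * (q - 1)) - T (s * (q - 1))) \<le> \<bar>s\<bar> ^ 3" "cmod (iexp (s * q) - T (s * q)) \<le> \<bar>s\<bar> ^ 3"
      using T[of "s * (q - 1)"] T[of "s * q"] by linarith+
  qed (use assms in auto)
  finally show ?thesis by (simp add: algebra_simps)
qed

lemma exp_minus_approx:
  fixes x :: real
  assumes "x \<ge> 0"
  shows "\<bar>exp (- x) - (1 - x)\<bar> \<le> x\<^sup>2"
proof -
  \<comment> \<open>The last comparison below rests on \<open>(1 - x + x\<^sup>2) (1 + x) = 1 + x\<^sup>3\<close>.\<close>
  have "exp (- x) \<le> 1 / (1 + x)"
    using exp_ge_add_one_self[of x] assms by (simp add: exp_minus divide_simps)
  also have "\<dots> \<le> 1 - x + x\<^sup>2"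
    using assms by (simp add: divide_simps power2_eq_square algebra_simps)
  finally show ?thesis using exp_ge_add_one_self[of "- x"] by simp
qed

definition peak_char :: "nat \<Rightarrow> real \<Rightarrow> complex" where
  "peak_char n s = average (perms n) (\<lambda>xs. iexp (s * peak_dev n xs))"

lemma peak_char_2: "peak_char 2 s = 1"
  using average_peaks_2[of "\<lambda>p. iexp (s * (real p - real (2 + 1) / 3))"]
  by (simp add: peak_char_def)

text \<open>One insertion turns the deviation \<open>Y\<close> into \<open>(1 - 2/(n+1)) Y\<close> minus a centred
  Bernoulli variable with parameter \<open>q = 2/3 + 2Y/(n+1)\<close>. Given \<open>Y\<close>, its characteristic
  function is \<open>1 - s\<^sup>2 q (1 - q) / 2\<close> up to \<open>\<bar>s\<bar>\<^sup>3\<close>. Replacing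
  \<open>q (1 - q)\<close> by \<open>2/9\<close> costs on average \<open>s\<^sup>2 / sqrt (n+1)\<close>, since the
  standard deviation of \<open>Y\<close> is at most \<open>sqrt n\<close>, and replacing \<open>1 -
  s\<^sup>2/9\<close> by an exponential costs \<open>s\<^sup>4\<close>.\<close>
lemma peak_char_Suc:
  assumes "n \<ge> 2"
  shows "cmod (peak_char (Suc n) s - of_real (exp (- s\<^sup>2 / 9)) * peak_char n (s * (1 - 2 / Suc n)))
    \<le> \<bar>s\<bar> ^ 3 + s\<^sup>2 / sqrt (Suc n) + s ^ 4"
proof -
  define M where "M = real (Suc n)"
  have M: "M > 0" "M \<noteq> 0" "real n = M - 1" by (auto simp: M_def)
  have cM: "complex_of_real M = 1 + of_nat n" by (simp add: M_def)
  define q where "q = (\<lambda>xs. 2 * real (peaks xs) / M)"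
  define B where "B = (\<lambda>q::real. q * iexp (s * (q - 1)) + (1 - q) * iexp (s * q))"
  define b where "b = exp (- s\<^sup>2 / 9)"
  define e where "e = (\<lambda>xs. iexp (s * (1 - 2 / M) * peak_dev n xs))"
  have "peak_char (Suc n) s = average (perms n) (\<lambda>xs. e xs * B (q xs))"
    unfolding peak_char_def
  proof -
    have "average (perms (Suc n)) (\<lambda>xs. iexp (s * peak_dev (Suc n) xs)) = average (perms n) (\<lambda>xs.
      (2 * peaks xs / Suc n) *\<^sub>R iexp (s * (real (peaks xs) - real (Suc n + 1) / 3)) + (1 - 2 * peaks xs / Suc n) *\<^sub>R
            iexp (s * (real (Suc (peaks xs)) - real (Suc n + 1) / 3)))"
      by (rule average_peaks_Suc[of n "\<lambda>p. iexp (s * (real p - real (Suc n + 1) / 3))"]) (use assms in simp)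
    also have "\<dots> = average (perms n) (\<lambda>xs. e xs * B (q xs))"
    proof (rule average_cong)
      fix xs
      let ?p = "real (peaks xs)"
      have 1: "s * (?p - real (Suc n + 1) / 3) = s * (1 - 2 / M) * peak_dev n xs + s * (q xs - 1)"
        using M by (simp add: q_def field_simps flip: M_def)
      have 2: "s * (real (Suc (peaks xs)) - real (Suc n + 1) / 3) = s * (1 - 2 / M) * peak_dev n xs + s * q xs"
        using M by (simp add: q_def field_simps flip: M_def)
      show "(2 * peaks xs / Suc n) *\<^sub>R iexp (s * (?p - real (Suc n + 1) / 3)) + (1 - 2 * peaks xs / Suc n) *\<^sub>R
            iexp (s * (real (Suc (peaks xs)) - real (Suc n + 1) / 3)) = e xs * B (q xs)"
        unfolding 1 2 e_def B_def of_real_add distrib_left exp_add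
        by (simp add: q_def cM scaleR_conv_of_real algebra_simps)
    qed
    finally show "average (perms (Suc n)) (\<lambda>xs. iexp (s * peak_dev (Suc n) xs)) = average (perms n) (\<lambda>xs. e xs * B (q xs))" .
  qed
  moreover have "b * peak_char n (s * (1 - 2 / Suc n)) = average (perms n) (\<lambda>xs. e xs * b)"
    unfolding peak_char_def e_def M_def by (simp add: average_cmult[symmetric] mult.commute)
  ultimately have "cmod (peak_char (Suc n) s - b * peak_char n (s * (1 - 2 / Suc n)))
     = cmod (average (perms n) (\<lambda>xs. e xs * (B (q xs) - b)))"
    by (simp add: average_diff[symmetric] right_diff_distrib)
  also have "\<dots> \<le> average (perms n) (\<lambda>xs. cmod (e xs * (B (q xs) - b)))" by (rule norm_average_le)
  also have "\<dots> \<le> average (perms n) (\<lambda>xs. (s\<^sup>2 / M) * \<bar>peak_dev n xs\<bar> + (\<bar>s\<bar> ^ 3 + s ^ 4))"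
  proof (rule average_mono)
    fix xs assume "xs \<in> perms n"
    note x = permsD[OF this]
    define r where "r = q xs"
    define u where "u = 2 / M * peak_dev n xs"
    have "2 * real (peaks xs) \<le> M" using two_peaks_le[of xs] x unfolding M_def by linarith
    hence r: "0 \<le> r" "r \<le> 1" using M by (auto simp: r_def q_def)
    have u: "r = 2 / 3 + u" using M by (simp add: r_def q_def u_def field_simps)
    have "r * (1 - r) - 2 / 9 = - u * (r - 1 / 3)" unfolding u by (simp add: algebra_simps add_divide_distrib diff_divide_distrib)
    hence "\<bar>r * (1 - r) - 2 / 9\<bar> = \<bar>u\<bar> * \<bar>r - 1 / 3\<bar>" by (simp add: abs_mult)
    also have "\<dots> \<le> \<bar>u\<bar> * 1" using r by (intro mult_left_mono) auto
    finally have v: "\<bar>r * (1 - r) - 2 / 9\<bar> \<le> \<bar>u\<bar>" by simp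
    have 1: "cmod (B r - (1 - s\<^sup>2 * (r * (1 - r)) / 2)) \<le> \<bar>s\<bar> ^ 3"
      unfolding B_def by (rule bernoulli_iexp_approx[OF r])
    have "cmod (complex_of_real (1 - s\<^sup>2 * (r * (1 - r)) / 2) - complex_of_real (1 - s\<^sup>2 / 9)) = s\<^sup>2 / 2 * \<bar>r * (1 - r) - 2 / 9\<bar>"
    proof -
      have "(1 - s\<^sup>2 * (r * (1 - r)) / 2) - (1 - s\<^sup>2 / 9) = - (s\<^sup>2 / 2) * (r * (1 - r) - 2 / 9)"
        by (simp add: field_simps)
      thus ?thesis by (simp only: of_real_diff[symmetric] norm_of_real) (simp add: abs_mult)
    qed
    also have "\<dots> \<le> s\<^sup>2 / 2 * \<bar>u\<bar>" using v by (intro mult_left_mono) auto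
    also have "\<dots> = s\<^sup>2 / M * \<bar>peak_dev n xs\<bar>" unfolding u_def abs_mult using M(1) by simp
    finally have 2: "cmod (complex_of_real (1 - s\<^sup>2 * (r * (1 - r)) / 2) - complex_of_real (1 - s\<^sup>2 / 9)) \<le> s\<^sup>2 / M * \<bar>peak_dev n xs\<bar>" .
    have "\<bar>(1 - s\<^sup>2 / 9) - b\<bar> \<le> (s\<^sup>2 / 9)\<^sup>2"
      using exp_minus_approx[of "s\<^sup>2 / 9"] unfolding b_def by (simp add: abs_minus_commute)
    also have "\<dots> \<le> s ^ 4" by (simp add: power_divide flip: power_mult)
    finally have 3: "cmod (complex_of_real (1 - s\<^sup>2 / 9) - b) \<le> s ^ 4"
      unfolding of_real_diff[symmetric] norm_of_real .
    have "cmod (B r - b) \<le> s\<^sup>2 / M * \<bar>peak_dev n xs\<bar> + (\<bar>s\<bar> ^ 3 + s ^ 4)"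
      using norm_diff_triangle_le[OF norm_diff_triangle_le[OF 1 2] 3]
      by (simp only: add.assoc add.commute add.left_commute)
    moreover have "cmod (e xs) = 1" by (simp add: e_def)
    ultimately show "cmod (e xs * (B (q xs) - b)) \<le> s\<^sup>2 / M * \<bar>peak_dev n xs\<bar> + (\<bar>s\<bar> ^ 3 + s ^ 4)"
      by (simp add: norm_mult r_def)
  qed
  also have "\<dots> = (s\<^sup>2 / M) * average (perms n) (\<lambda>xs. \<bar>peak_dev n xs\<bar>) + (\<bar>s\<bar> ^ 3 + s ^ 4)"
    by (simp only: average_add average_cmult) (simp add: average_const)
  also have "\<dots> \<le> (s\<^sup>2 / M) * sqrt M + (\<bar>s\<bar> ^ 3 + s ^ 4)"
  proof (intro add_right_mono mult_left_mono)
    have "average (perms n) (\<lambda>xs. \<bar>peak_dev n xs\<bar>) \<le> sqrt (average (perms n) (\<lambda>xs. (peak_dev n xs)\<^sup>2))"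
      by (rule average_abs_le) auto
    also have "\<dots> \<le> sqrt M" using average_peak_dev_sq_le[OF assms] M by simp
    finally show "average (perms n) (\<lambda>xs. \<bar>peak_dev n xs\<bar>) \<le> sqrt M" .
  qed (use M in auto)
  also have "(s\<^sup>2 / M) * sqrt M = s\<^sup>2 / sqrt M" using M by (simp add: real_div_sqrt field_simps)
  finally show ?thesis by (simp add: M_def b_def)
qed

text \<open>The weights \<open>j (j - 1)\<close> are the martingale normalization: multiplying \<open>s (Suc
  m)\<close> by the factor \<open>1 - 2/(m+1)\<close> of the recursion gives \<open>s m\<close>. The recursion starts
  at 2, where the deviation is identically 0.\<close>
lemma peak_char_approx:
  fixes \<tau> :: real
  defines "s \<equiv> \<lambda>j. \<tau> * (real j * (real j - 1))"
  assumes "m \<ge> 2"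
  shows "cmod (peak_char m (s m) - of_real (exp (- (\<Sum>j=3..m. (s j)\<^sup>2) / 9)))
    \<le> (\<Sum>j=3..m. \<bar>s j\<bar> ^ 3 + (s j)\<^sup>2 / sqrt j + s j ^ 4)"
  using assms(2)
proof (induction m rule: dec_induct)
  case base
  show ?case by (simp add: peak_char_2)
next
  case (step m)
  let ?eS = "complex_of_real (exp (- (\<Sum>j=3..m. (s j)\<^sup>2) / 9))"
  let ?eb = "complex_of_real (exp (- (s (Suc m))\<^sup>2 / 9))"
  have s: "s (Suc m) * (1 - 2 / real (Suc m)) = s m"
    by (simp add: s_def field_simps)
  have e: "complex_of_real (exp (- (\<Sum>j=3..Suc m. (s j)\<^sup>2) / 9)) = ?eb * ?eS"
    using step.hyps by (simp add: exp_add[symmetric] add_divide_distrib diff_divide_distrib del: of_real_mult flip: of_real_mult)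
  have "cmod (peak_char (Suc m) (s (Suc m)) - ?eb * ?eS)
     \<le> cmod (peak_char (Suc m) (s (Suc m)) - ?eb * peak_char m (s m))
       + cmod (?eb * (peak_char m (s m) - ?eS))"
    using norm_triangle_ineq[of "peak_char (Suc m) (s (Suc m)) - ?eb * peak_char m (s m)" "?eb * (peak_char m (s m) - ?eS)"]
    by (simp add: algebra_simps)
  also have "cmod (?eb * (peak_char m (s m) - ?eS)) \<le> cmod (peak_char m (s m) - ?eS)"
    by (simp add: norm_mult mult_left_le_one_le)
  finally show ?case
    unfolding e using peak_char_Suc[of m "s (Suc m)"] step unfolding s by simp
qed

lemma sum_weights: "(\<Sum>j=1..n. (real j * (real j - 1))\<^sup>2) = real n * (real n ^ 2 - 1) * (3 * real n ^ 2 - 2) / 15"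
  by (induction n) (auto simp: field_simps power2_eq_square)

lemma sum_inverse_sqrt_le: "(\<Sum>j=1..n. 1 / sqrt (real j)) \<le> 2 * sqrt (real n)"
proof (induction n)
  case (Suc n)
  have "1 / sqrt (Suc n) \<le> 2 * sqrt (Suc n) - 2 * sqrt n"
  proof -
    define x y where "x = sqrt (Suc n)" and "y = sqrt n"
    have "x\<^sup>2 = y\<^sup>2 + 1" "x > 0" "0 \<le> y" by (auto simp: x_def y_def)
    \<comment> \<open>Since \<open>x\<^sup>2 - y\<^sup>2 = 1\<close>, the claim \<open>1 \<le> 2 x\<^sup>2 - 2 x y\<close> is exactly this square.\<close>
    moreover have "(x - y)\<^sup>2 \<ge> 0" by simp
    ultimately have "1 / x \<le> 2 * x - 2 * y" by (simp add: field_simps power2_eq_square)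
    thus ?thesis by (simp add: x_def y_def)
  qed
  thus ?case using Suc by simp
qed simp

text \<open>With \<open>\<tau>\<close> chosen such that the last weight is the standardizing factor \<open>a
  n\<close>, every earlier weight is at most \<open>\<bar>a n\<bar> = O(1 / sqrt n)\<close>, which makes the
  accumulated error vanish, and the sum of squares converges to \<open>9 t\<^sup>2 / 2\<close>.\<close>
lemma peak_char_tendsto:
  "(\<lambda>n. peak_char n (t / sqrt (2 * real (n + 1) / 45))) \<longlonglongrightarrow> of_real (exp (- t\<^sup>2 / 2))"
proof -
  define a where "a = (\<lambda>n. t / sqrt (2 * real (n + 1) / 45))"
  define \<tau> where "\<tau> = (\<lambda>n. a n / (real n * (real n - 1)))"
  define s where "s = (\<lambda>n j. \<tau> n * (real j * (real j - 1)))"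
  define S where "S = (\<lambda>n. \<Sum>j=3..n. (s n j)\<^sup>2)"
  define err where "err = (\<lambda>n. real n * \<bar>a n\<bar> ^ 3 + (a n)\<^sup>2 * (2 * sqrt n) + real n * a n ^ 4)"
  have bound: "cmod (peak_char n (a n) - of_real (exp (- S n / 9))) \<le> err n" if "n \<ge> 2" for n
  proof -
    have sn: "\<tau> n * (real n * (real n - 1)) = a n" using that by (simp add: \<tau>_def)
    have le: "\<bar>s n j\<bar> \<le> \<bar>a n\<bar>" if "j \<in> {3..n}" for j
    proof -
      have "real j * (real j - 1) \<le> real n * (real n - 1)" using that by (intro mult_mono) auto
      moreover have "real j * (real j - 1) > 0" using that by auto
      ultimately have "\<bar>(real j * (real j - 1)) / (real n * (real n - 1))\<bar> \<le> 1"
        by (simp only: abs_divide) (simp add: divide_le_eq_1)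
      hence "\<bar>a n\<bar> * \<bar>(real j * (real j - 1)) / (real n * (real n - 1))\<bar> \<le> \<bar>a n\<bar>" by (intro mult_left_le) auto
      thus ?thesis by (simp add: s_def \<tau>_def abs_mult[symmetric])
    qed
    have "cmod (peak_char n (a n) - of_real (exp (- S n / 9)))
       \<le> (\<Sum>j=3..n. \<bar>s n j\<bar> ^ 3 + (s n j)\<^sup>2 / sqrt j + s n j ^ 4)"
      using peak_char_approx[OF that, of "\<tau> n"] by (simp add: s_def S_def sn)
    also have "\<dots> \<le> (\<Sum>j=3..n. \<bar>a n\<bar> ^ 3 + (a n)\<^sup>2 * (1 / sqrt j) + a n ^ 4)"
    proof (intro sum_mono add_mono)
      fix j assume j: "j \<in> {3..n}"
      show "\<bar>s n j\<bar> ^ 3 \<le> \<bar>a n\<bar> ^ 3" using le[OF j] by (intro power_mono) auto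
      have 2: "(s n j)\<^sup>2 \<le> (a n)\<^sup>2" using le[OF j] by (rule abs_le_square_iff[THEN iffD1])
      thus "(s n j)\<^sup>2 / sqrt j \<le> (a n)\<^sup>2 * (1 / sqrt j)" by (simp add: divide_right_mono)
      show "s n j ^ 4 \<le> a n ^ 4" using power_mono[OF 2, of 2] by (simp flip: power_mult)
    qed
    also have "\<dots> \<le> (\<Sum>j=1..n. \<bar>a n\<bar> ^ 3 + (a n)\<^sup>2 * (1 / sqrt j) + a n ^ 4)"
      by (intro sum_mono2) auto
    also have "\<dots> = real n * \<bar>a n\<bar> ^ 3 + (a n)\<^sup>2 * (\<Sum>j=1..n. 1 / sqrt j) + real n * a n ^ 4"
      by (simp add: sum.distrib sum_distrib_left)
    also have "\<dots> \<le> err n"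
      unfolding err_def by (intro add_mono mult_left_mono sum_inverse_sqrt_le) auto
    finally show ?thesis .
  qed
  have err: "err \<longlonglongrightarrow> 0"
  proof -
    define D where "D = (\<lambda>n. sqrt (2 * real (n + 1) / 45))"
    have "(\<lambda>n. real n / D n ^ 3) \<longlonglongrightarrow> 0" "(\<lambda>n. 2 * sqrt (real n) / (D n)\<^sup>2) \<longlonglongrightarrow> 0"
        "(\<lambda>n. real n / D n ^ 4) \<longlonglongrightarrow> 0"
      unfolding D_def by real_asymp+
    hence lim: "(\<lambda>n. \<bar>t\<bar> ^ 3 * (real n / D n ^ 3) + t\<^sup>2 * (2 * sqrt (real n) / (D n)\<^sup>2) + t ^ 4 * (real n / D n ^ 4))
        \<longlonglongrightarrow> \<bar>t\<bar> ^ 3 * 0 + t\<^sup>2 * 0 + t ^ 4 * 0"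
      by (intro tendsto_intros)
    have "err = (\<lambda>n. \<bar>t\<bar> ^ 3 * (real n / D n ^ 3) + t\<^sup>2 * (2 * sqrt (real n) / (D n)\<^sup>2) + t ^ 4 * (real n / D n ^ 4))"
    proof
      fix n
      have "a n = t / D n" "D n \<ge> 0" by (simp_all add: a_def D_def)
      thus "err n = \<bar>t\<bar> ^ 3 * (real n / D n ^ 3) + t\<^sup>2 * (2 * sqrt (real n) / (D n)\<^sup>2) + t ^ 4 * (real n / D n ^ 4)"
        by (simp add: err_def power_divide abs_divide mult.commute)
    qed
    thus ?thesis using lim by simp
  qed
  have S: "S \<longlonglongrightarrow> 9 * t\<^sup>2 / 2"
  proof -
    have eq: "S n = t\<^sup>2 * ((1 / (2 * real (n + 1) / 45)) / (real n * (real n - 1))\<^sup>2 *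
         (real n * (real n ^ 2 - 1) * (3 * real n ^ 2 - 2) / 15 - 4))" if "n \<ge> 2" for n
    proof -
      have "{1..n} = {1, 2} \<union> {3..n}" using that by auto
      hence "(\<Sum>j=1..n. (real j * (real j - 1))\<^sup>2)
          = (\<Sum>j\<in>{1, 2}. (real j * (real j - 1))\<^sup>2) + (\<Sum>j=3..n. (real j * (real j - 1))\<^sup>2)"
        by (simp only:) (rule sum.union_disjoint; auto)
      hence w: "(\<Sum>j=3..n. (real j * (real j - 1))\<^sup>2) = real n * (real n ^ 2 - 1) * (3 * real n ^ 2 - 2) / 15 - 4"
        using sum_weights[of n] by simp
      have "S n = (\<tau> n)\<^sup>2 * (\<Sum>j=3..n. (real j * (real j - 1))\<^sup>2)"
        unfolding S_def s_def power_mult_distrib[of "\<tau> n"] sum_distrib_left ..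
      moreover have "(\<tau> n)\<^sup>2 = (t\<^sup>2 / (2 * real (n + 1) / 45)) / (real n * (real n - 1))\<^sup>2"
        by (simp add: \<tau>_def a_def power_divide power_mult_distrib)
      ultimately show ?thesis using w by simp
    qed
    have "(\<lambda>n. (1 / (2 * real (n + 1) / 45)) / (real n * (real n - 1))\<^sup>2 *
         (real n * (real n ^ 2 - 1) * (3 * real n ^ 2 - 2) / 15 - 4)) \<longlonglongrightarrow> 9 / 2"
      by real_asymp
    from tendsto_mult_left[OF this, of "t\<^sup>2"]
    have "(\<lambda>n. t\<^sup>2 * ((1 / (2 * real (n + 1) / 45)) / (real n * (real n - 1))\<^sup>2 *
         (real n * (real n ^ 2 - 1) * (3 * real n ^ 2 - 2) / 15 - 4))) \<longlonglongrightarrow> 9 * t\<^sup>2 / 2"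
      by (simp only: times_divide_eq_right mult.commute[of "t\<^sup>2" 9])
    thus ?thesis by (rule Lim_transform_eventually) (use eq in \<open>auto intro!: eventually_sequentiallyI[of 2]\<close>)
  qed
  have "(\<lambda>n. peak_char n (a n) - of_real (exp (- S n / 9))) \<longlonglongrightarrow> 0"
    by (rule Lim_null_comparison[OF _ err]) (use bound in \<open>auto intro!: eventually_sequentiallyI[of 2]\<close>)
  moreover have "(\<lambda>n. complex_of_real (exp (- S n / 9))) \<longlonglongrightarrow> of_real (exp (- (9 * t\<^sup>2 / 2) / 9))"
    by (intro tendsto_intros S) auto
  ultimately have "(\<lambda>n. (peak_char n (a n) - of_real (exp (- S n / 9))) + of_real (exp (- S n / 9))) \<longlonglongrightarrow> 0 + of_real (exp (- (9 * t\<^sup>2 / 2) / 9))"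
    by (rule tendsto_add)
  thus ?thesis by (simp add: a_def)
qed

section \<open>Uniform permutations as words\<close>

abbreviation perm_fns :: "nat \<Rightarrow> (nat \<Rightarrow> nat) set" where
  "perm_fns n \<equiv> {\<sigma>. \<sigma> permutes {1..n}}"

lemma perm_fns: "finite (perm_fns n)" "perm_fns n \<noteq> {}" "card (perm_fns n) = fact n"
proof -
  show "finite (perm_fns n)" by (rule finite_permutations) simp
  show "perm_fns n \<noteq> {}" using permutes_id by blast
  show "card (perm_fns n) = fact n" by (rule card_permutations) simp_all
qed

lemma bij_word: "bij_betw (\<lambda>\<sigma>. map \<sigma> [1..<Suc n]) (perm_fns n) (perms n)"
proof -
  let ?f = "\<lambda>\<sigma>. map \<sigma> [1..<Suc n]"
  have inj: "inj_on ?f (perm_fns n)"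
  proof (rule inj_onI, clarify)
    fix \<sigma> \<pi> assume s: "\<sigma> permutes {1..n}" "\<pi> permutes {1..n}" "?f \<sigma> = ?f \<pi>"
    show "\<sigma> = \<pi>"
    proof
      fix i show "\<sigma> i = \<pi> i"
      proof (cases "i \<in> {1..n}")
        case True
        hence "i \<in> set [1..<Suc n]" by (simp only: set_upt) auto
        thus ?thesis using s(3) by (simp only: map_eq_conv)
      next
        case False
        thus ?thesis using s by (simp add: permutes_not_in)
      qed
    qed
  qed
  have sub: "?f ` perm_fns n \<subseteq> perms n"
  proof clarify
    fix \<sigma> assume s: "\<sigma> permutes {1..n}"
    have "set [1..<Suc n] = {1..n}" by (simp only: set_upt) auto
    hence "set (?f \<sigma>) = {1..n}" using permutes_image[OF s] by (simp only: set_map)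
    moreover have "distinct (?f \<sigma>)"
      using permutes_inj_on[OF s] by (simp only: distinct_map) simp
    ultimately show "?f \<sigma> \<in> perms n" by (intro permutations_of_setI)
  qed
  have "card (?f ` perm_fns n) = card (perms n)" using card_image[OF inj] perm_fns(3) by simp
  with sub have "?f ` perm_fns n = perms n" by (intro card_subset_eq) auto
  with inj show ?thesis by (simp add: bij_betw_def)
qed

lemma average_perm_fns:
  "average (perm_fns n) (\<lambda>\<sigma>. h (map \<sigma> [1..<Suc n])) = average (perms n) h"
  unfolding average_def sum.reindex_bij_betw[OF bij_word, of h] bij_betw_same_card[OF bij_word] ..

lemma expectation_uniform_perm:
  fixes f :: "(nat \<Rightarrow> nat) \<Rightarrow> 'b :: {banach, second_countable_topology}"
  shows "measure_pmf.expectation (uniform_perm n) f = average (perm_fns n) f"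
proof -
  have "measure_pmf.expectation (uniform_perm n) f = (\<Sum>\<sigma>\<in>perm_fns n. pmf (uniform_perm n) \<sigma> *\<^sub>R f \<sigma>)"
    using perm_fns[of n] by (intro integral_measure_pmf) (auto simp: uniform_perm_def)
  also have "\<dots> = (\<Sum>\<sigma>\<in>perm_fns n. f \<sigma> /\<^sub>R real (card (perm_fns n)))"
    using perm_fns[of n] by (intro sum.cong) (auto simp: uniform_perm_def divide_inverse)
  finally show ?thesis by (simp add: average_def scaleR_sum_right)
qed

section \<open>Transfer to the longest alternating subsequence\<close>

lemma iexp_average_diff_le:
  "cmod (average A (\<lambda>x. iexp (t * f x)) - average A (\<lambda>x. iexp (t * g x)))
     \<le> \<bar>t\<bar> * average A (\<lambda>x. \<bar>f x - g x\<bar>)"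
proof -
  have lip: "cmod (iexp u - iexp v) \<le> \<bar>u - v\<bar>" for u v :: real
  proof -
    have "iexp u - iexp v = iexp v * (iexp (u - v) - 1)"
      by (simp add: algebra_simps exp_add[symmetric])
    hence "cmod (iexp u - iexp v) = cmod (iexp (u - v) - 1)" by (simp add: norm_mult)
    also have "\<dots> \<le> \<bar>u - v\<bar>" using iexp_approx1[of "u - v" 0] by simp
    finally show ?thesis .
  qed
  have "cmod (average A (\<lambda>x. iexp (t * f x) - iexp (t * g x)))
     \<le> average A (\<lambda>x. cmod (iexp (t * f x) - iexp (t * g x)))" by (rule norm_average_le)
  also have "\<dots> \<le> average A (\<lambda>x. \<bar>t\<bar> * \<bar>f x - g x\<bar>)"
  proof (rule average_mono)
    fix x show "cmod (iexp (t * f x) - iexp (t * g x)) \<le> \<bar>t\<bar> * \<bar>f x - g x\<bar>"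
      using lip[of "t * f x" "t * g x"] by (simp add: abs_mult[symmetric] right_diff_distrib)
  qed
  finally show ?thesis by (simp add: average_cmult average_diff)
qed

definition twice_peaks :: "nat \<Rightarrow> (nat \<Rightarrow> nat) \<Rightarrow> real" where
  "twice_peaks n \<sigma> = 2 * real (peaks (map \<sigma> [1..<Suc n]))"

lemma average_twice_peaks:
  assumes "n \<ge> 2"
  shows "average (perm_fns n) (twice_peaks n) = 2 * (real (n + 1) / 3)"
proof -
  have "average (perms n) (\<lambda>xs. real (peaks xs)) = average (perms n) (\<lambda>xs. peak_dev n xs + real (n + 1) / 3)"
    by simp
  also have "\<dots> = average (perms n) (peak_dev n) + real (n + 1) / 3"
    by (subst average_add) (simp add: average_const)
  also have "\<dots> = real (n + 1) / 3" using average_peak_dev[OF assms] by simp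
  finally have "average (perms n) (\<lambda>xs. 2 * real (peaks xs)) = 2 * (real (n + 1) / 3)"
    by (simp add: average_cmult)
  thus ?thesis
    unfolding twice_peaks_def using average_perm_fns[of n "\<lambda>xs. 2 * real (peaks xs)"] by simp
qed

lemma twice_peaks_dev:
  assumes "n \<ge> 2"
  shows "twice_peaks n \<sigma> - average (perm_fns n) (twice_peaks n) = 2 * peak_dev n (map \<sigma> [1..<Suc n])"
  unfolding average_twice_peaks[OF assms] twice_peaks_def by (simp only: right_diff_distrib)

lemma std_dev_twice_peaks:
  assumes "n \<ge> 4"
  shows "std_dev (perm_fns n) (twice_peaks n) = 2 * sqrt (2 * real (n + 1) / 45)"
proof -
  have "std_dev (perm_fns n) (twice_peaks n) = rms (perm_fns n) (\<lambda>\<sigma>. 2 * peak_dev n (map \<sigma> [1..<Suc n]))"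
    unfolding std_dev_def using assms by (subst twice_peaks_dev) auto
  also have "\<dots> = 2 * sqrt (average (perm_fns n) (\<lambda>\<sigma>. (peak_dev n (map \<sigma> [1..<Suc n]))\<^sup>2))"
    unfolding rms_cmult by (simp only: rms_def abs_numeral)
  also have "\<dots> = 2 * sqrt (2 * real (n + 1) / 45)"
    unfolding average_perm_fns[of n "\<lambda>xs. (peak_dev n xs)\<^sup>2"] average_peak_dev_sq[OF assms] ..
  finally show ?thesis .
qed

lemma rms_las_minus_twice_peaks:
  assumes "k \<ge> 1"
  shows "rms (perm_fns n) (\<lambda>\<sigma>. real (las n k \<sigma>) - twice_peaks n \<sigma>) \<le> sqrt (8 + 8 * (4 * k\<^sup>2 + 3 * k))"
proof -
  have "rms (perm_fns n) (\<lambda>\<sigma>. real (las n k \<sigma>) - twice_peaks n \<sigma>)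
      \<le> rms (perm_fns n) (\<lambda>\<sigma>. 2 + 2 * real (close_pairs k (map \<sigma> [1..<Suc n])))"
    unfolding twice_peaks_def by (rule rms_mono) (rule las_near_peaks[OF assms])
  also have "\<dots> = sqrt (average (perms n) (\<lambda>xs. (2 + 2 * real (close_pairs k xs))\<^sup>2))"
    unfolding rms_def average_perm_fns[of n "\<lambda>xs. (2 + 2 * real (close_pairs k xs))\<^sup>2"] ..
  also have "\<dots> \<le> sqrt (average (perms n) (\<lambda>xs. 8 + 8 * (real (close_pairs k xs))\<^sup>2))"
  proof (intro real_sqrt_le_mono average_mono)
    fix xs
    define c where "c = real (close_pairs k xs)"
    \<comment> \<open>This is \<open>(x + y)\<^sup>2 \<le> 2 x\<^sup>2 + 2 y\<^sup>2\<close>.\<close>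
    have "(2 * c - 2)\<^sup>2 \<ge> 0" by simp
    thus "(2 + 2 * c)\<^sup>2 \<le> 8 + 8 * c\<^sup>2" by (simp add: power2_eq_square algebra_simps)
  qed
  also have "\<dots> = sqrt (8 + 8 * average (perms n) (\<lambda>xs. (real (close_pairs k xs))\<^sup>2))"
    by (simp only: average_add average_cmult) (simp add: average_const)
  also have "\<dots> \<le> sqrt (8 + 8 * (4 * k\<^sup>2 + 3 * k))"
    using average_close_pairs(2)[of n k] by (intro real_sqrt_le_mono) simp
  finally show ?thesis .
qed

lemma twice_peaks_char_tendsto:
  "(\<lambda>n. average (perm_fns n) (\<lambda>\<sigma>. iexp (t * ((twice_peaks n \<sigma> - average (perm_fns n) (twice_peaks n))
      / std_dev (perm_fns n) (twice_peaks n))))) \<longlonglongrightarrow> of_real (exp (- t\<^sup>2 / 2))"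
proof (rule Lim_transform_eventually[OF peak_char_tendsto[of t]])
  show "\<forall>\<^sub>F n in sequentially. peak_char n (t / sqrt (2 * real (n + 1) / 45)) =
    average (perm_fns n) (\<lambda>\<sigma>. iexp (t * ((twice_peaks n \<sigma> - average (perm_fns n) (twice_peaks n))
      / std_dev (perm_fns n) (twice_peaks n))))"
  proof (rule eventually_sequentiallyI[of 4])
    fix n :: nat assume n: "n \<ge> 4"
    let ?D = "sqrt (2 * real (n + 1) / 45)"
    have "t * ((twice_peaks n \<sigma> - average (perm_fns n) (twice_peaks n)) / std_dev (perm_fns n) (twice_peaks n))
       = t / ?D * peak_dev n (map \<sigma> [1..<Suc n])" for \<sigma>
    proof -
      have "n \<ge> 2" using n by simp
      have cancel: "t * ((2 * x) / (2 * d)) = t / d * x" for x d :: real by simp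
      show ?thesis unfolding twice_peaks_dev[OF \<open>n \<ge> 2\<close>] std_dev_twice_peaks[OF n] by (rule cancel)
    qed
    thus "peak_char n (t / ?D) =
      average (perm_fns n) (\<lambda>\<sigma>. iexp (t * ((twice_peaks n \<sigma> - average (perm_fns n) (twice_peaks n))
      / std_dev (perm_fns n) (twice_peaks n))))"
      unfolding peak_char_def using average_perm_fns[of n "\<lambda>xs. iexp (t / ?D * peak_dev n xs)"] by simp
  qed
qed

text \<open>The bound \<open>R\<close> on the root mean square of the difference is independent of \<open>n\<close>,
  whereas the deviation \<open>w n\<close> of twice the number of peaks tends to infinity. Hence the deviation of the
  length, which is at least \<open>w n - R\<close>, is eventually positive.\<close>
lemma las_char_tendsto:
  assumes "k \<ge> 1"
  defines "Z \<equiv> \<lambda>n \<sigma>. real (las n k \<sigma>)"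
  shows "(\<lambda>n. average (perm_fns n) (\<lambda>\<sigma>. iexp (t * ((Z n \<sigma> - average (perm_fns n) (Z n))
      / std_dev (perm_fns n) (Z n))))) \<longlonglongrightarrow> of_real (exp (- t\<^sup>2 / 2))"
proof -
  define R where "R = sqrt (8 + 8 * (4 * k\<^sup>2 + 3 * k))"
  define F where "F = (\<lambda>f n. average (perm_fns n) (\<lambda>\<sigma>. iexp (t * ((f n \<sigma> - average (perm_fns n) (f n))
      / std_dev (perm_fns n) (f n)))))"
  define w where "w = (\<lambda>n. 2 * sqrt (2 * real (n + 1) / 45))"
  have rms: "rms (perm_fns n) (\<lambda>\<sigma>. Z n \<sigma> - twice_peaks n \<sigma>) \<le> R" for n
    unfolding Z_def R_def by (rule rms_las_minus_twice_peaks[OF assms(1)])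
  have "filterlim w at_top sequentially" unfolding w_def by real_asymp
  hence ev: "\<forall>\<^sub>F n in sequentially. w n > R" by (simp add: filterlim_at_top_dense)
  have "\<forall>\<^sub>F n in sequentially. cmod (F Z n - F twice_peaks n) \<le> \<bar>t\<bar> * (2 * R / (w n - R))"
    using ev eventually_ge_at_top[of 4]
  proof eventually_elim
    case (elim n)
    have sw: "std_dev (perm_fns n) (twice_peaks n) = w n"
      using std_dev_twice_peaks[OF elim(2)] by (simp add: w_def)
    have "rms (perm_fns n) (\<lambda>\<sigma>. twice_peaks n \<sigma> - Z n \<sigma>) = rms (perm_fns n) (\<lambda>\<sigma>. Z n \<sigma> - twice_peaks n \<sigma>)"
      using rms_cmult[of "perm_fns n" "-1" "\<lambda>\<sigma>. Z n \<sigma> - twice_peaks n \<sigma>"] by simp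
    hence sz: "std_dev (perm_fns n) (Z n) \<ge> w n - R"
      using std_dev_le[OF perm_fns(1,2), of n "twice_peaks n" "Z n"] rms[of n] sw by simp
    have R: "R \<ge> 0" by (simp add: R_def)
    have pos: "std_dev (perm_fns n) (Z n) > 0" "std_dev (perm_fns n) (twice_peaks n) > 0"
      using elim(1) sz sw R by linarith+
    have "cmod (F Z n - F twice_peaks n) \<le> \<bar>t\<bar> * average (perm_fns n) (\<lambda>\<sigma>.
        \<bar>(Z n \<sigma> - average (perm_fns n) (Z n)) / std_dev (perm_fns n) (Z n)
        - (twice_peaks n \<sigma> - average (perm_fns n) (twice_peaks n)) / std_dev (perm_fns n) (twice_peaks n)\<bar>)"
      unfolding F_def by (rule iexp_average_diff_le)
    also have "\<dots> \<le> \<bar>t\<bar> * (2 * rms (perm_fns n) (\<lambda>\<sigma>. Z n \<sigma> - twice_peaks n \<sigma>) / std_dev (perm_fns n) (Z n))"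
      by (intro mult_left_mono standardized_near perm_fns pos) auto
    also have "\<dots> \<le> \<bar>t\<bar> * (2 * R / (w n - R))"
      using rms[of n] sz elim(1) R by (intro mult_left_mono frac_le) auto
    finally show ?case .
  qed
  moreover have "(\<lambda>n. \<bar>t\<bar> * (2 * R / (w n - R))) \<longlonglongrightarrow> 0"
  proof -
    have "filterlim (\<lambda>n. w n - R) at_top sequentially" unfolding w_def by real_asymp
    hence "(\<lambda>n. 2 * R / (w n - R)) \<longlonglongrightarrow> 0"
      by (intro tendsto_divide_0[OF tendsto_const] filterlim_at_top_imp_at_infinity)
    from tendsto_mult_left[OF this, of "\<bar>t\<bar>"] show ?thesis by simp
  qed
  ultimately have "(\<lambda>n. F Z n - F twice_peaks n) \<longlonglongrightarrow> 0" by (rule Lim_null_comparison)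
  moreover have "F twice_peaks \<longlonglongrightarrow> of_real (exp (- t\<^sup>2 / 2))"
    unfolding F_def by (rule twice_peaks_char_tendsto)
  ultimately have "(\<lambda>n. (F Z n - F twice_peaks n) + F twice_peaks n) \<longlonglongrightarrow> 0 + of_real (exp (- t\<^sup>2 / 2))"
    by (rule tendsto_add)
  thus ?thesis unfolding F_def by simp
qed

theorem theorem3p1:
  fixes k :: nat
  assumes "k \<ge> 1"
  shows "weak_conv_m
    (\<lambda>n. distr (measure_pmf (uniform_perm n)) borel
       (\<lambda>\<sigma>. (real (las n k \<sigma>) - measure_pmf.expectation (uniform_perm n) (\<lambda>\<tau>. real (las n k \<tau>)))
             / sqrt (measure_pmf.variance (uniform_perm n) (\<lambda>\<tau>. real (las n k \<tau>)))))
    std_normal_distribution"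
proof (rule levy_continuity)
  fix n
  show "real_distribution (distr (measure_pmf (uniform_perm n)) borel
       (\<lambda>\<sigma>. (real (las n k \<sigma>) - measure_pmf.expectation (uniform_perm n) (\<lambda>\<tau>. real (las n k \<tau>)))
             / sqrt (measure_pmf.variance (uniform_perm n) (\<lambda>\<tau>. real (las n k \<tau>)))))"
    by (rule prob_space.real_distribution_distr[OF measure_pmf.prob_space_axioms]) simp
next
  show "real_distribution std_normal_distribution" by (rule real_dist_normal_dist)
next
  fix t
  have sd: "sqrt (measure_pmf.variance (uniform_perm n) f) = std_dev (perm_fns n) f" for n and f :: "(nat \<Rightarrow> nat) \<Rightarrow> real"
    by (simp only: expectation_uniform_perm std_dev_def rms_def)
  show "(\<lambda>n. char (distr (measure_pmf (uniform_perm n)) borel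
       (\<lambda>\<sigma>. (real (las n k \<sigma>) - measure_pmf.expectation (uniform_perm n) (\<lambda>\<tau>. real (las n k \<tau>)))
             / sqrt (measure_pmf.variance (uniform_perm n) (\<lambda>\<tau>. real (las n k \<tau>))))) t)
      \<longlonglongrightarrow> char std_normal_distribution t"
    unfolding char_def[of "distr _ _ _"] sd char_std_normal_distribution
    using las_char_tendsto[OF assms, of t]
    by (simp add: integral_distr expectation_uniform_perm)
qed

end
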